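(* Let $s\in\mathbb N\cup\{\infty\}$ and let $d\in\mathbb N\cup\{\infty\}$ satisfy $2|d|[2,s]$. Then we have the easy envelope formula $$(H_N^{s,d})^1=H_N^s$$ unless we are in the case $(N,s,d)=(2,4,2)$, which is exceptional, with $(H_2^{4,2})^1=H_2^{4,2}$.
   Context: $\mathbb Z_s\subset\mathbb T$ is the group of $s$-th roots of unity, with $\mathbb Z_\infty=\mathbb T$, and $[2,s]$ is the least common multiple. $H_N^s\subset U_N$ is the group of $N\times N$ monomial matrices (one nonzero entry in each row and column) with nonzero entries in $\mathbb Z_s$, and $H_N^{s,d}=\{g\in H_N^s\,|\,\det g\in\mathbb Z_d\}$. Under the condition $2|d|[2,s]$ the group $H_N^{s,d}$ is homogeneous, i.e. contains the group $S_N$ of permutation matrices. $C(U_N^+)$ is the universal $C^*$-algebra generated by the entries of an $N\times N$ matrix $u=(u_{ij})$ subject to $u^*=u^{-1}$, $u^t=\bar u^{-1}$, with its standard compact quantum group structure; $U_N\subset U_N^+$. Colored integers are finite words in $\circ,\bullet$; $u^{\otimes k}$ is defined by $u^\circ=u$, $u^\bullet=\bar u$ and multiplicativity. The Tannakian category of a closed subgroup $G\subset U_N^+$ is $C(k,l)=Hom(u^{\otimes k},u^{\otimes l})$, and determines $G$. $P(k,l)$ is the set of partitions of an upper row of points colored by $k$ and a lower row of points colored by $l$. For $\pi\in P(k,l)$, $T_\pi(e_{i_1}\otimes\ldots\otimes e_{i_k})=\sum_{j_1\ldots j_l}\delta_\pi(i;j)\,e_{j_1}\otimes\ldots\otimes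 e_{j_l}$, where $\delta_\pi(i;j)=1$ if each block of $\pi$ contains equal indices, and $0$ otherwise. Easy envelope: for homogeneous $S_N\subset G\subset U_N^+$ with Tannakian category $C$, the sets $D^1(k,l)=\{\pi\in P(k,l)\,|\,T_\pi\in C(k,l)\}$ form a category of partitions, and the easy envelope $G^1$ is the easy quantum group with Tannakian category $span(T_\pi|\pi\in D^1(k,l))$.
   Formalization: The formula as stated fails for N=2 whenever s is finite and 2d|s (e.g. (2,8,2), not only (2,4,2)), and for N=1 unless s|d (e.g. (1,4,2)); the formal theorem excludes exactly these cases and keeps the (2,4,2) claim. *)

theory Defs
  imports "HOL-Analysis.Analysis"
begin

section \<open>Linear spans of complex-valued functions\<close>

definition lin_span :: "('a \<Rightarrow> complex) set \<Rightarrow> ('a \<Rightarrow> complex) set" where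
  "lin_span S = {(\<lambda>x. \<Sum>f\<in>F. c f * f x) | F c. finite F \<and> F \<subseteq> S}"

section \<open>Colored integers and the free $*$-algebra on the entries of $u$\<close>

datatype colour = White | Black

type_synonym colword = "colour list"

text \<open>
  The size of the matrices is $N$ = \<open>CARD('n)\<close>. The generator \<open>(White, i, j)\<close> is $u_{ij}$, and
  \<open>(Black, i, j)\<close> is $u_{ij}^*$, the $(i,j)$ entry of $\bar u$. A monomial is a list of generators,
  and an element of the free unital $*$-algebra is its (finitely supported) coefficient function.
\<close>

type_synonym 'n gen = "colour \<times> 'n \<times> 'n"
type_synonym 'n ncpoly = "'n gen list \<Rightarrow> complex"

fun opp :: "colour \<Rightarrow> colour" where
  "opp White = Black"
| "opp Black = White"

definition free_alg :: "'n ncpoly set" where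
  "free_alg = {f. finite {w. f w \<noteq> 0}}"

definition mon :: "'n gen list \<Rightarrow> 'n ncpoly" where
  "mon v = (\<lambda>w. if w = v then 1 else 0)"

definition nc_mult :: "'n ncpoly \<Rightarrow> 'n ncpoly \<Rightarrow> 'n ncpoly" where
  "nc_mult f g = (\<lambda>w. \<Sum>m\<le>length w. f (take m w) * g (drop m w))"

definition nc_star :: "'n ncpoly \<Rightarrow> 'n ncpoly" where
  "nc_star f = (\<lambda>w. cnj (f (rev (map (\<lambda>(c, i, j). (opp c, i, j)) w))))"

text \<open>The linear antimultiplicative map with $u_{ij} \mapsto u_{ji}^*$, $u_{ij}^* \mapsto u_{ji}$.\<close>

definition nc_antipode :: "'n ncpoly \<Rightarrow> 'n ncpoly" where
  "nc_antipode f = (\<lambda>w. f (rev (map (\<lambda>(c, i, j). (opp c, j, i)) w)))"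

text \<open>The unital homomorphism with $u_{ij}, u_{ij}^* \mapsto \delta_{ij}$.\<close>

definition nc_counit :: "'n ncpoly \<Rightarrow> complex" where
  "nc_counit f = (\<Sum>w | f w \<noteq> 0. f w * (if \<forall>(c, i, j)\<in>set w. i = j then 1 else 0))"

text \<open>
  The entry $u^{\otimes k}_{i_1 \ldots i_p, j_1 \ldots j_p} = u^{k_1}_{i_1 j_1} \cdots
  u^{k_p}_{i_p j_p}$, as a monomial.
\<close>

definition entry :: "colword \<Rightarrow> 'n list \<Rightarrow> 'n list \<Rightarrow> 'n gen list" where
  "entry k is js = zip k (zip is js)"

text \<open>
  The homomorphism with $u_{ij} \mapsto \sum_m u_{im} \otimes u_{mj}$ and $u_{ij}^* \mapsto \sum_m
  u_{im}^* \otimes u_{mj}^*$, so $u^{\otimes k}_{ij} \mapsto \sum_m u^{\otimes k}_{im} \otimes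
  u^{\otimes k}_{mj}$ for multi-indices. Elements of the tensor square are coefficient functions on
  pairs of monomials.
\<close>

definition nc_comult :: "'n ncpoly \<Rightarrow> 'n gen list \<times> 'n gen list \<Rightarrow> complex" where
  "nc_comult f = (\<lambda>(v, w).
     if map fst v = map fst w \<and> map (snd \<circ> snd) v = map (fst \<circ> snd) w
     then f (entry (map fst v) (map (fst \<circ> snd) v) (map (snd \<circ> snd) w))
     else 0)"

definition nc_tensor :: "'n ncpoly \<Rightarrow> 'n ncpoly \<Rightarrow> 'n gen list \<times> 'n gen list \<Rightarrow> complex" where
  "nc_tensor f g = (\<lambda>(v, w). f v * g w)"

section \<open>Closed subgroups of $U_N^+$\<close>

definition nc_kron :: "'n \<Rightarrow> 'n \<Rightarrow> 'n ncpoly" where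
  "nc_kron i j = (\<lambda>w. if i = j then mon [] w else 0)"

text \<open>The entries of $uu^*-1$, $u^*u-1$, $\bar u u^t-1$, $u^t\bar u-1$.\<close>

definition biunitarity :: "('n::finite) ncpoly set" where
  "biunitarity =
     {(\<lambda>w. (\<Sum>m\<in>UNIV. mon [(White, i, m), (Black, j, m)] w) - nc_kron i j w) | i j. True} \<union>
     {(\<lambda>w. (\<Sum>m\<in>UNIV. mon [(Black, m, i), (White, m, j)] w) - nc_kron i j w) | i j. True} \<union>
     {(\<lambda>w. (\<Sum>m\<in>UNIV. mon [(Black, i, m), (White, j, m)] w) - nc_kron i j w) | i j. True} \<union>
     {(\<lambda>w. (\<Sum>m\<in>UNIV. mon [(White, m, i), (Black, m, j)] w) - nc_kron i j w) | i j. True}"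

definition star_ideal :: "'n ncpoly set \<Rightarrow> bool" where
  "star_ideal I \<longleftrightarrow>
     I \<subseteq> free_alg \<and> (\<lambda>_. 0) \<in> I \<and>
     (\<forall>f\<in>I. \<forall>g\<in>I. (\<lambda>w. f w + g w) \<in> I) \<and>
     (\<forall>c. \<forall>f\<in>I. (\<lambda>w. c * f w) \<in> I) \<and>
     (\<forall>a\<in>free_alg. \<forall>f\<in>I. nc_mult a f \<in> I \<and> nc_mult f a \<in> I) \<and>
     (\<forall>f\<in>I. nc_star f \<in> I)"

text \<open>
  A closed subgroup $G \subset U_N^+$ is given by a Woronowicz algebra $(C(G), u)$ generated by the
  entries of a biunitary $u$, two such being identified when the $*$-algebras generated by these
  entries are isomorphic via $u_{ij} \mapsto u_{ij}$. So $G$ is represented by the ideal of all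
  $*$-polynomial relations between the $u_{ij}$. The ideals arising in this way are the Hopf
  $*$-ideals which contain the biunitarity relations: a Hopf $*$-algebra generated by the
  entries of a biunitary corepresentation has an enveloping $C^*$-algebra in which it embeds.
\<close>

definition qsubgroup :: "('n::finite) ncpoly set \<Rightarrow> bool" where
  "qsubgroup I \<longleftrightarrow>
     star_ideal I \<and> biunitarity \<subseteq> I \<and>
     (\<forall>f\<in>I. nc_comult f \<in>
        lin_span ({nc_tensor a b | a b. a \<in> I \<and> b \<in> free_alg} \<union>
                  {nc_tensor a b | a b. a \<in> free_alg \<and> b \<in> I})) \<and>
     (\<forall>f\<in>I. nc_counit f = 0) \<and>
     (\<forall>f\<in>I. nc_antipode f \<in> I)"

text \<open>
  A group of unitary matrices as a subgroup of $U_N \subset U_N^+$: the relations between the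
  coordinate functions $u_{ij}$ on it.
\<close>

fun gen_eval :: "complex^'n^'n \<Rightarrow> 'n gen \<Rightarrow> complex" where
  "gen_eval g (White, i, j) = g $ i $ j"
| "gen_eval g (Black, i, j) = cnj (g $ i $ j)"

definition nc_eval :: "complex^'n^'n \<Rightarrow> 'n ncpoly \<Rightarrow> complex" where
  "nc_eval g f = (\<Sum>w | f w \<noteq> 0. f w * (\<Prod>x\<leftarrow>w. gen_eval g x))"

definition classical :: "(complex^'n^'n) set \<Rightarrow> 'n ncpoly set" where
  "classical G = {f\<in>free_alg. \<forall>g\<in>G. nc_eval g f = 0}"

definition perm_matrices :: "(complex^'n^'n) set" where
  "perm_matrices = {(\<chi> i j. if i = \<sigma> j then 1 else 0) | \<sigma>. bij \<sigma>}"

text \<open>Inclusions of subgroups reverse inclusions of ideals, so this is $S_N \subset G \subset U_N^+$.\<close>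

definition homogeneous :: "('n::finite) ncpoly set \<Rightarrow> bool" where
  "homogeneous G \<longleftrightarrow> qsubgroup G \<and> G \<subseteq> classical perm_matrices"

section \<open>Tannakian categories, partitions, easy envelopes\<close>

definition multi_idx :: "colword \<Rightarrow> 'n list set" where
  "multi_idx k = {is. length is = length k}"

text \<open>
  An operator from the tensor power indexed by \<open>k\<close> to that indexed by \<open>l\<close> is its matrix \<open>T (j, i)\<close>,
  with \<open>j\<close> the output and \<open>i\<close> the input multi-index, extended by \<open>0\<close>. The category consists of the
  \<open>T\<close> with $u^{\otimes l} T = T u^{\otimes k}$.
\<close>

definition tannaka ::
  "('n::finite) ncpoly set \<Rightarrow> colword \<Rightarrow> colword \<Rightarrow> ('n list \<times> 'n list \<Rightarrow> complex) set" where
  "tannaka G k l =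
     {T. (\<forall>j i. (j, i) \<notin> multi_idx l \<times> multi_idx k \<longrightarrow> T (j, i) = 0) \<and>
         (\<forall>j\<in>multi_idx l. \<forall>i\<in>multi_idx k.
            (\<lambda>w. (\<Sum>j'\<in>multi_idx l. T (j', i) * mon (entry l j j') w)
               - (\<Sum>i'\<in>multi_idx k. T (j, i') * mon (entry k i' i) w)) \<in> G)}"

text \<open>\<open>Inl p\<close> is the upper point in position \<open>p\<close>, and \<open>Inr q\<close> the lower point in position \<open>q\<close>.\<close>

definition partitions :: "colword \<Rightarrow> colword \<Rightarrow> (nat + nat) set set set" where
  "partitions k l = {\<pi>. partition_on ({..<length k} <+> {..<length l}) \<pi>}"

definition T_part ::
  "colword \<Rightarrow> colword \<Rightarrow> (nat + nat) set set \<Rightarrow> 'n list \<times> 'n list \<Rightarrow> complex" where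
  "T_part k l \<pi> = (\<lambda>(j, i).
     if j \<in> multi_idx l \<and> i \<in> multi_idx k \<and>
        (\<forall>B\<in>\<pi>. \<forall>x\<in>B. \<forall>y\<in>B. case_sum (nth i) (nth j) x = case_sum (nth i) (nth j) y)
     then 1 else 0)"

definition D1 :: "('n::finite) ncpoly set \<Rightarrow> colword \<Rightarrow> colword \<Rightarrow> (nat + nat) set set set" where
  "D1 G k l = {\<pi>\<in>partitions k l. T_part k l \<pi> \<in> tannaka G k l}"

text \<open>
  \<open>easy_envelope G K\<close> says that $K = G^1$. It is stated as a relation; a closed subgroup of $U_N^+$ is
  determined by its Tannakian category, so for each \<open>G\<close> there is at most one such \<open>K\<close>.
\<close>

definition easy_envelope :: "('n::finite) ncpoly set \<Rightarrow> 'n ncpoly set \<Rightarrow> bool" where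
  "easy_envelope G K \<longleftrightarrow>
     homogeneous G \<and> qsubgroup K \<and>
     (\<forall>k l. tannaka K k l = lin_span (T_part k l ` D1 G k l))"

section \<open>The complex reflection groups\<close>

definition root_group :: "enat \<Rightarrow> complex set" where
  "root_group s = (case s of enat n \<Rightarrow> {z. z ^ n = 1} | \<infinity> \<Rightarrow> {z. norm z = 1})"

definition lcm_two :: "enat \<Rightarrow> enat" where
  "lcm_two s = (case s of enat n \<Rightarrow> enat (lcm 2 n) | \<infinity> \<Rightarrow> \<infinity>)"

definition monomial_matrix :: "complex^'n^'n \<Rightarrow> bool" where
  "monomial_matrix g \<longleftrightarrow> (\<forall>i. \<exists>!j. g $ i $ j \<noteq> 0) \<and> (\<forall>j. \<exists>!i. g $ i $ j \<noteq> 0)"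

definition H :: "enat \<Rightarrow> (complex^'n^'n) set" where
  "H s = {g. monomial_matrix g \<and> (\<forall>i j. g $ i $ j \<noteq> 0 \<longrightarrow> g $ i $ j \<in> root_group s)}"

definition H_det :: "enat \<Rightarrow> enat \<Rightarrow> (complex^'n^'n) set" where
  "H_det s d = {g\<in>H s. det g \<in> root_group d}"

section \<open>Where the formula $(H_N^{s,d})^1 = H_N^s$ fails\<close>

text \<open>
  For $N = 2$ and $2d \mid s < \infty$ put $h = s/2$. Then $\sum_{a,b} e_a^{\otimes h} \otimes
  e_b^{\otimes h}$, which is $T_\pi$ for the partition of $2h$ lower white points into two blocks of
  size $h$, is fixed by $H_2^{s,d}$ and not by $H_2^s$. So $(2,4,2)$ is only the first member of a
  family of exceptions, the next ones being $(2,8,2)$ and $(2,8,4)$. For $N = 1$ the groups are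
  $\mathbb{Z}_s \cap \mathbb{Z}_d$ and $\mathbb{Z}_s$, and the formula fails unless $s \mid d$.
\<close>


lemma nc_eval_superset:
  assumes "finite S" "\<And>w. f w \<noteq> 0 \<Longrightarrow> w \<in> S"
  shows "nc_eval g f = (\<Sum>w\<in>S. f w * (\<Prod>x\<leftarrow>w. gen_eval g x))"
  unfolding nc_eval_def using assms by (intro sum.mono_neutral_left) auto

lemma tannaka_classical_fix:
  fixes G :: "(complex^'n::finite^'n) set"
  shows "T \<in> tannaka (classical G) [] l \<longleftrightarrow>
    (\<forall>j i. (j, i) \<notin> multi_idx l \<times> multi_idx [] \<longrightarrow> T (j, i) = 0) \<and>
    (\<forall>j\<in>multi_idx l. \<forall>g\<in>G.
       (\<Sum>j'\<in>multi_idx l. T (j', []) * (\<Prod>x\<leftarrow>entry l j j'. gen_eval g x)) = T (j, []))"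
proof -
  have fin: "finite (multi_idx l :: 'n list set)"
    using finite_lists_length_eq[of "UNIV :: 'n set" "length l"] by (simp add: multi_idx_def)
  have idx0: "multi_idx [] = {[] :: 'n list}" by (auto simp: multi_idx_def)
  have key: "(\<lambda>w. (\<Sum>j'\<in>multi_idx l. T (j', []) * mon (entry l j j') w) - T (j, []) * mon [] w)
      \<in> classical G \<longleftrightarrow>
    (\<forall>g\<in>G. (\<Sum>j'\<in>multi_idx l. T (j', []) * (\<Prod>x\<leftarrow>entry l j j'. gen_eval g x)) = T (j, []))"
    (is "?f \<in> _ \<longleftrightarrow> _") for j
  proof -
    let ?S = "insert [] (entry l j ` multi_idx l)"
    have S: "finite ?S" using fin by simp
    have sub: "w \<in> ?S" if "?f w \<noteq> 0" for w
    proof (rule ccontr)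
      assume "w \<notin> ?S"
      then have "mon [] w = 0" "\<And>j'. j' \<in> multi_idx l \<Longrightarrow> mon (entry l j j') w = 0"
        by (auto simp: mon_def)
      with that show False by simp
    qed
    have free: "?f \<in> free_alg"
      unfolding free_alg_def using finite_subset[OF _ S, of "{w. ?f w \<noteq> 0}"] sub by blast
    have mon_sum: "(\<Sum>w\<in>?S. mon v w * P w) = P v" if "v \<in> ?S" for v and P :: "_ \<Rightarrow> complex"
    proof -
      have "(\<Sum>w\<in>?S. mon v w * P w) = (\<Sum>w\<in>?S. if w = v then P w else 0)"
        by (intro sum.cong) (auto simp: mon_def)
      also have "\<dots> = P v" using S that by (simp add: sum.delta)
      finally show ?thesis .
    qed
    have ev: "nc_eval g ?f =
      (\<Sum>j'\<in>multi_idx l. T (j', []) * (\<Prod>x\<leftarrow>entry l j j'. gen_eval g x)) - T (j, [])" for g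
    proof -
      let ?P = "\<lambda>w. \<Prod>x\<leftarrow>w. gen_eval g x"
      have "nc_eval g ?f = (\<Sum>w\<in>?S. ?f w * ?P w)"
        by (rule nc_eval_superset[OF S sub])
      also have "\<dots> = (\<Sum>w\<in>?S. \<Sum>j'\<in>multi_idx l. T (j', []) * (mon (entry l j j') w * ?P w))
          - (\<Sum>w\<in>?S. T (j, []) * (mon [] w * ?P w))"
        by (simp only: left_diff_distrib sum_subtractf sum_distrib_right mult.assoc)
      also have "(\<Sum>w\<in>?S. \<Sum>j'\<in>multi_idx l. T (j', []) * (mon (entry l j j') w * ?P w)) =
          (\<Sum>j'\<in>multi_idx l. T (j', []) * (\<Sum>w\<in>?S. mon (entry l j j') w * ?P w))"
        by (subst sum.swap) (simp only: sum_distrib_left)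
      also have "\<dots> = (\<Sum>j'\<in>multi_idx l. T (j', []) * ?P (entry l j j'))"
        by (intro sum.cong refl arg_cong2[where f="(*)"] mon_sum) auto
      also have "(\<Sum>w\<in>?S. T (j, []) * (mon [] w * ?P w)) = T (j, []) * ?P []"
        unfolding sum_distrib_left[symmetric] by (subst mon_sum) auto
      finally show ?thesis by simp
    qed
    show ?thesis unfolding classical_def using free by (simp add: ev)
  qed
  have "entry [] i i' = []" for i i' :: "'n list" by (simp add: entry_def)
  then show ?thesis
    unfolding tannaka_def idx0 by (simp add: key)
qed

definition col_sum :: "complex^'n^'n \<Rightarrow> ('n::finite) list \<Rightarrow> complex" where
  "col_sum g js = (\<Sum>a\<in>UNIV. \<Prod>x\<leftarrow>js. g $ x $ a)"

lemma col_sum_replicate: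
  assumes "monomial_matrix g" "0 < h" "g $ r $ c \<noteq> 0"
  shows "col_sum g (replicate h r) = (g $ r $ c) ^ h"
proof -
  have z: "g $ r $ a = 0" if "a \<noteq> c" for a
    using assms that unfolding monomial_matrix_def by metis
  have "col_sum g (replicate h r) = (\<Sum>a\<in>UNIV. if a = c then (g $ r $ c) ^ h else 0)"
    unfolding col_sum_def using z assms(2) by (intro sum.cong) (auto simp: prod_list_replicate)
  then show ?thesis by simp
qed

lemma col_sum_other:
  assumes "monomial_matrix g" "x \<in> set js" "y \<in> set js" "x \<noteq> y"
  shows "col_sum g js = 0"
  unfolding col_sum_def
proof (intro sum.neutral ballI)
  fix a
  have "g $ x $ a = 0 \<or> g $ y $ a = 0"
    using assms unfolding monomial_matrix_def by metis
  then show "(\<Prod>x\<leftarrow>js. g $ x $ a) = 0"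
    using assms(2,3) by (auto simp: prod_list_zero_iff image_iff)
qed

lemma prod_entry_replicate:
  "length js = m \<Longrightarrow>
   (\<Prod>x\<leftarrow>entry (replicate m White) js (replicate m a). gen_eval g x) = (\<Prod>x\<leftarrow>js. g $ x $ a)"
  by (induction js arbitrary: m) (auto simp: entry_def)

lemma entry_append:
  "length k = length i \<Longrightarrow> length k = length j \<Longrightarrow>
   entry (k @ k') (i @ i') (j @ j') = entry k i j @ entry k' i' j'"
  by (simp add: entry_def)

definition two_blocks :: "nat \<Rightarrow> (nat + nat) set set" where
  "two_blocks h = {Inr ` {..<h}, Inr ` {h..<h + h}}"

lemma replicate_iff: "xs = replicate h a \<longleftrightarrow> length xs = h \<and> (\<forall>p<h. xs ! p = a)"
  by (metis length_replicate nth_equalityI nth_replicate)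

lemma T_two_blocks:
  assumes "0 < h"
  shows "T_part [] (replicate (h + h) White) (two_blocks h) (j, i) =
    (if i = [] \<and> (\<exists>a b. j = replicate h a @ replicate h b) then 1 else 0)"
proof -
  have *: "(length j = h + h \<and> (\<forall>p\<in>{..<h}. \<forall>q\<in>{..<h}. j ! p = j ! q) \<and>
           (\<forall>p\<in>{h..<h+h}. \<forall>q\<in>{h..<h+h}. j ! p = j ! q)) \<longleftrightarrow>
        (\<exists>a b. j = replicate h a @ replicate h b)" (is "?L \<longleftrightarrow> ?R")
  proof
    assume L: ?L
    have "take h j = replicate h (j ! 0)"
      unfolding replicate_iff
    proof (intro conjI allI impI)
      show "length (take h j) = h" using L by simp
      fix p assume "p < h" then show "take h j ! p = j ! 0" using L[THEN conjunct2, THEN conjunct1, THEN bspec[of _ _ p], THEN bspec[of _ _ 0]] assms by simp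
    qed
    moreover have "drop h j = replicate h (j ! h)"
      unfolding replicate_iff
    proof (intro conjI allI impI)
      show "length (drop h j) = h" using L by simp
      fix p assume p: "p < h"
      then have "j ! (h + p) = j ! h" using L[THEN conjunct2, THEN conjunct2, THEN bspec[of _ _ "h + p"], THEN bspec[of _ _ h]] assms by simp
      then show "drop h j ! p = j ! h" using L by simp
    qed
    ultimately show ?R by (metis append_take_drop_id)
  next
    assume ?R then show ?L by (auto simp: nth_append)
  qed
  show ?thesis
    unfolding T_part_def two_blocks_def multi_idx_def *[symmetric]
    by (simp only: prod.case ball_simps image_iff sum.case mem_Collect_eq length_replicate list.size
        length_0_conv simp_thms conj_ac)
qed

lemma partition_two_blocks:
  "0 < h \<Longrightarrow> two_blocks h \<in> partitions [] (replicate (h + h) White)"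
  unfolding partitions_def two_blocks_def partition_on_def disjoint_def Plus_def
  by (fastforce simp: image_iff)

lemma T_one_block:
  fixes j i :: "'n::finite list"
  assumes "CARD('n) = 1"
  shows "T_part [] (replicate m White) {Inr ` {..<m}} (j, i) =
    (if i = [] \<and> length j = m then 1 else 0)"
proof -
  have "x = y" for x y :: 'n using assms by (metis card_1_singletonE UNIV_I singletonD)
  then show ?thesis by (auto simp: T_part_def multi_idx_def)
qed

lemma partition_one_block:
  "0 < m \<Longrightarrow> {Inr ` {..<m}} \<in> partitions [] (replicate m White)"
  by (auto simp: partitions_def partition_on_def Plus_def image_iff)

lemma fix_two_blocks:
  fixes G :: "(complex^'n::finite^'n) set"
  assumes h: "0 < h"
  shows "T_part [] (replicate (h + h) White) (two_blocks h)
           \<in> tannaka (classical G) [] (replicate (h + h) White) \<longleftrightarrow>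
    (\<forall>j. length j = h + h \<longrightarrow> (\<forall>g\<in>G. col_sum g (take h j) * col_sum g (drop h j) =
        (if \<exists>a b. j = replicate h a @ replicate h b then 1 else 0)))"
proof -
  let ?l = "replicate (h + h) White"
  let ?T = "T_part [] ?l (two_blocks h) :: 'n list \<times> 'n list \<Rightarrow> complex"
  have fin: "finite {is :: 'n list. length is = h + h}"
    using finite_lists_length_eq[of "UNIV :: 'n set" "h + h"] by simp
  have eq: "(\<Sum>j'\<in>multi_idx ?l. ?T (j', []) * (\<Prod>x\<leftarrow>entry ?l j j'. gen_eval g x)) =
      col_sum g (take h j) * col_sum g (drop h j)" if j: "length j = h + h" for j and g :: "complex^'n^'n"
  proof -
    let ?r = "\<lambda>(a, b). replicate h a @ replicate h b"
    have inj: "inj_on ?r (UNIV :: ('n \<times> 'n) set)" using h by (auto simp: inj_on_def)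
    have "(\<Sum>j'\<in>multi_idx ?l. ?T (j', []) * (\<Prod>x\<leftarrow>entry ?l j j'. gen_eval g x)) =
       (\<Sum>j'\<in>range ?r. \<Prod>x\<leftarrow>entry ?l j j'. gen_eval g x)"
      by (rule sum.mono_neutral_cong_right) (auto simp: multi_idx_def fin T_two_blocks[OF h])
    also have "\<dots> = (\<Sum>(a, b)\<in>UNIV. \<Prod>x\<leftarrow>entry ?l j (replicate h a @ replicate h b). gen_eval g x)"
      by (subst sum.reindex[OF inj]) (simp add: case_prod_unfold)
    also have "\<dots> = (\<Sum>(a, b)\<in>UNIV \<times> UNIV. (\<Prod>x\<leftarrow>take h j. g $ x $ a) * (\<Prod>x\<leftarrow>drop h j. g $ x $ b))"
    proof (simp only: UNIV_Times_UNIV, intro sum.cong refl, clarify)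
      fix a b
      have "entry ?l j (replicate h a @ replicate h b) =
         entry (replicate h White) (take h j) (replicate h a) @
         entry (replicate h White) (drop h j) (replicate h b)"
        using entry_append[of "replicate h White" "take h j" "replicate h a" "replicate h White" "drop h j"] j
        by (simp add: replicate_add)
      then show "(\<Prod>x\<leftarrow>entry ?l j (replicate h a @ replicate h b). gen_eval g x) =
          (\<Prod>x\<leftarrow>take h j. g $ x $ a) * (\<Prod>x\<leftarrow>drop h j. g $ x $ b)"
        using j by (simp add: prod_entry_replicate)
    qed
    also have "\<dots> = col_sum g (take h j) * col_sum g (drop h j)"
      by (simp add: col_sum_def sum_product sum.cartesian_product)
    finally show ?thesis .
  qed
  have "(\<forall>j\<in>multi_idx ?l. \<forall>g\<in>G.
      (\<Sum>j'\<in>multi_idx ?l. ?T (j', []) * (\<Prod>x\<leftarrow>entry ?l j j'. gen_eval g x)) = ?T (j, [])) \<longleftrightarrow>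
    (\<forall>j\<in>multi_idx ?l. \<forall>g\<in>G. col_sum g (take h j) * col_sum g (drop h j) = ?T (j, []))"
    by (intro ball_cong refl, subst eq) (simp_all add: multi_idx_def)
  moreover have "\<forall>j i. (j, i) \<notin> multi_idx ?l \<times> multi_idx [] \<longrightarrow> ?T (j, i) = 0"
    by (auto simp: T_part_def)
  ultimately show ?thesis
    unfolding tannaka_classical_fix by (simp add: multi_idx_def T_two_blocks[OF h])
qed

lemma fix_one_block:
  fixes G :: "(complex^'n::finite^'n) set"
  assumes N: "CARD('n) = 1" and m: "0 < m"
  shows "T_part [] (replicate m White) {Inr ` {..<m}}
           \<in> tannaka (classical G) [] (replicate m White) \<longleftrightarrow>
    (\<forall>r. \<forall>g\<in>G. (g $ r $ r) ^ m = 1)"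
proof -
  obtain r :: 'n where r: "UNIV = {r}" using N by (metis card_1_singletonE)
  have x: "x = r" for x using r by auto
  have lists: "length j = m \<longleftrightarrow> j = replicate m r" for j
    using x by (auto simp: replicate_iff)
  have "(\<Prod>x\<leftarrow>entry (replicate m White) (replicate m r) (replicate m r). gen_eval g x) = (g $ r $ r) ^ m"
    for g :: "complex^'n^'n"
    by (simp add: prod_entry_replicate prod_list_replicate)
  moreover have "(\<forall>r. \<forall>g\<in>G. (g $ r $ r) ^ m = 1) \<longleftrightarrow> (\<forall>g\<in>G. (g $ r $ r) ^ m = 1)"
    using x by metis
  ultimately show ?thesis
    by (subst tannaka_classical_fix) (auto simp: multi_idx_def T_one_block[OF N] lists)
qed

lemma category_neq:
  fixes G K :: "('n::finite) ncpoly set"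
  assumes "\<pi> \<in> partitions k l" "(T_part k l \<pi> :: 'n list \<times> 'n list \<Rightarrow> complex) \<in> tannaka G k l"
    "(T_part k l \<pi> :: 'n list \<times> 'n list \<Rightarrow> complex) \<notin> tannaka K k l"
  shows "tannaka K k l \<noteq> lin_span (T_part k l ` D1 G k l)"
proof -
  have "(T_part k l \<pi> :: 'n list \<times> 'n list \<Rightarrow> complex) \<in> lin_span (T_part k l ` D1 G k l)"
    unfolding lin_span_def using assms
    by (auto simp: D1_def intro!: exI[of _ "{T_part k l \<pi>}"] exI[of _ "\<lambda>_. 1"])
  then show ?thesis using assms(3) by metis
qed

lemma enat_dvd_iff: "enat a dvd enat b \<longleftrightarrow> a dvd b"
proof
  assume "enat a dvd enat b"
  then obtain k where k: "enat b = enat a * k" by (auto simp: dvd_def)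
  show "a dvd b"
  proof (cases k)
    case (enat x) with k show ?thesis by simp
  next
    case infinity with k show ?thesis by (cases "a = 0") (auto simp: enat_0 [symmetric] zero_enat_def)
  qed
qed (auto simp: dvd_def simp flip: times_enat_simps(1))

definition diag_one :: "'n \<Rightarrow> complex \<Rightarrow> complex^('n::finite)^'n" where
  "diag_one r z = (\<chi> i j. if i = j then (if i = r then z else 1) else 0)"

lemma diag_one_H:
  assumes "z \<in> root_group s" "z \<noteq> 0"
  shows "diag_one r z \<in> H s"
proof -
  have "1 \<in> root_group s" by (cases s) (auto simp: root_group_def)
  with assms show ?thesis
    by (auto simp: H_def monomial_matrix_def diag_one_def)
qed

lemma H_fails_one:
  assumes N: "CARD('n::finite) = 1" and "d \<noteq> 0" "\<not> s dvd d" "s \<noteq> 0"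
  shows "\<exists>k l. tannaka (classical (H s :: (complex^'n^'n) set)) k l
           \<noteq> lin_span (T_part k l ` D1 (classical (H_det s d :: (complex^'n^'n) set)) k l)"
proof -
  obtain m where m: "d = enat m" "0 < m"
  proof (cases d)
    case (enat m) with that assms(2) show ?thesis by (auto simp: zero_enat_def)
  next
    case infinity
    then have "d = s * \<infinity>" using assms(4) by (cases s) (auto simp: zero_enat_def)
    then show ?thesis using assms(3) by auto
  qed
  obtain r :: 'n where r: "UNIV = {r}" using N by (metis card_1_singletonE)
  have det: "det g = g $ r $ r" for g :: "complex^'n^'n"
    unfolding det_def r by (simp add: permutes_sing)
  obtain z where z: "z \<in> root_group s" "z \<noteq> 0" "z ^ m \<noteq> 1"
  proof (cases s)
    case (enat n)
    then have n: "0 < n" "\<not> n dvd m" using assms m by (auto simp: enat_dvd_iff zero_enat_def)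
    have "real n * (2 * pi / n) = 2 * pi" using n by simp
    then have "cis (2 * pi / n) ^ n = 1" by (simp only: Complex.DeMoivre cis_2pi)
    moreover have "cis (2 * pi / n) ^ m \<noteq> 1"
    proof
      assume "cis (2 * pi / n) ^ m = 1"
      then have "cos (real m * (2 * pi / n)) = 1"
        by (simp add: Complex.DeMoivre complex_eq_iff)
      then obtain x :: int where "real m * (2 * pi / n) = x * 2 * pi"
        by (auto simp: cos_one_2pi_int)
      then have "real m = x * real n" using n by (simp add: field_simps)
      then have "int m = x * int n" by (metis of_int_eq_iff of_int_mult of_int_of_nat_eq)
      then have "int n dvd int m" by simp
      then show False using n by simp
    qed
    ultimately show ?thesis using that[of "cis (2 * pi / n)"] enat by (auto simp: root_group_def)
  next
    case infinity
    have "cis (pi / m) ^ m = -1" using m by (simp add: Complex.DeMoivre)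
    then show ?thesis using that[of "cis (pi / m)"] infinity by (auto simp: root_group_def)
  qed
  show ?thesis
  proof (intro exI, rule category_neq[OF partition_one_block[OF m(2)]])
    show "T_part [] (replicate m White) {Inr ` {..<m}}
           \<in> tannaka (classical (H_det s d :: (complex^'n^'n) set)) [] (replicate m White)"
      unfolding fix_one_block[OF N m(2)] using r
      by (auto simp: H_det_def det m root_group_def)
    show "T_part [] (replicate m White) {Inr ` {..<m}}
           \<notin> tannaka (classical (H s :: (complex^'n^'n) set)) [] (replicate m White)"
      unfolding fix_one_block[OF N m(2)]
      using diag_one_H[OF z(1,2), of r] z(3) by (auto simp: diag_one_def intro!: exI[of _ r] bexI[of _ "diag_one r z"])
  qed
qed

lemma H_fails_two:
  assumes N: "CARD('n::finite) = 2" and s: "s \<noteq> 0" "s \<noteq> \<infinity>" and d: "2 dvd d" "2 * d dvd s"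
  shows "\<exists>k l. tannaka (classical (H s :: (complex^'n^'n) set)) k l
           \<noteq> lin_span (T_part k l ` D1 (classical (H_det s d :: (complex^'n^'n) set)) k l)"
proof -
  obtain n where n: "s = enat n" "0 < n" using s by (cases s) (auto simp: zero_enat_def)
  obtain e where e: "d = enat e"
  proof (cases d)
    case infinity
    then have "2 * d = \<infinity>" by (simp add: numeral_eq_enat)
    with d obtain x where "enat n = \<infinity> * x" by (auto simp: dvd_def n)
    then show ?thesis using n(2) by (cases x) (auto simp: zero_enat_def split: if_splits)
  qed
  have "2 * e dvd n" "even e" using d unfolding n e by (auto simp: numeral_eq_enat enat_dvd_iff)
  then obtain k where k: "n = 2 * e * k" by (auto elim: dvdE)
  define h where "h = e * k"
  have h: "n = h + h" "e dvd h" "even h" "0 < h"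
    using k n(2) \<open>even e\<close> by (auto simp: h_def)
  obtain r t :: 'n where rt: "UNIV = {r, t}" "r \<noteq> t" using N by (auto simp: card_2_iff)
  have det: "det g = g $ r $ r * g $ t $ t - g $ r $ t * g $ t $ r" for g :: "complex^'n^'n"
    unfolding det_def rt(1) using rt(2)
    by (simp add: sum_over_permutations_insert permutes_sing sign_swap_id sign_id)
  have inv: "col_sum g (take h j) * col_sum g (drop h j) =
        (if \<exists>a b. j = replicate h a @ replicate h b then 1 else 0)"
    if j: "length j = h + h" and g: "g \<in> H_det s d" for j and g :: "complex^'n^'n"
  proof (cases "\<exists>a b. j = replicate h a @ replicate h b")
    case True
    then obtain a b where ab: "j = replicate h a @ replicate h b" by blast
    have mg: "monomial_matrix g" using g by (auto simp: H_det_def H_def)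
    have rts: "x ^ (h + h) = 1" if "x = g $ p $ q" "x \<noteq> 0" for x p q
      using g that by (auto simp: H_det_def H_def root_group_def n h)
    obtain c1 c2 where c: "g $ r $ c1 \<noteq> 0" "g $ t $ c2 \<noteq> 0" "c1 \<noteq> c2"
      using mg rt(2) unfolding monomial_matrix_def by metis
    have c12: "(c1 = r \<and> c2 = t) \<or> (c1 = t \<and> c2 = r)" using rt c(3) by (metis UNIV_I insertE singletonD)
    have "det g ^ h = 1" using g h(2) by (auto simp: H_det_def root_group_def e dvd_def power_mult)
    moreover have "det g = g $ r $ c1 * g $ t $ c2 \<or> det g = - (g $ r $ c1 * g $ t $ c2)"
    proof -
      have "\<And>i j j'. g $ i $ j \<noteq> 0 \<Longrightarrow> g $ i $ j' \<noteq> 0 \<Longrightarrow> j = j'"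
        using mg unfolding monomial_matrix_def by blast
      then have "g $ r $ c2 = 0" "g $ t $ c1 = 0" using c by blast+
      then show ?thesis using c12 by (auto simp: det)
    qed
    ultimately have "(g $ r $ c1 * g $ t $ c2) ^ h = 1"
      using h(3) by (metis power_minus_even)
    then have p: "(g $ r $ c1) ^ h * (g $ t $ c2) ^ h = 1"
      by (simp only: power_mult_distrib)
    have cs: "col_sum g (replicate h r) = (g $ r $ c1) ^ h" "col_sum g (replicate h t) = (g $ t $ c2) ^ h"
      using col_sum_replicate[OF mg h(4)] c by auto
    have sq: "(g $ r $ c1) ^ h * (g $ r $ c1) ^ h = 1" "(g $ t $ c2) ^ h * (g $ t $ c2) ^ h = 1"
      using rts c by (auto simp flip: power_add)
    have "a = r \<or> a = t" "b = r \<or> b = t" using rt by auto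
    then show ?thesis using True ab cs p sq by (auto simp: mult.commute)
  next
    case False
    have mg: "monomial_matrix g" using g by (auto simp: H_det_def H_def)
    have const: "xs = replicate h (hd xs)" if "length xs = h" "\<And>x y. x \<in> set xs \<Longrightarrow> y \<in> set xs \<Longrightarrow> x = y" for xs :: "'n list"
      using that h(4) by (metis replicate_eqI length_greater_0_conv list.set_sel(1))
    have "(\<exists>x y. x \<in> set (take h j) \<and> y \<in> set (take h j) \<and> x \<noteq> y) \<or>
          (\<exists>x y. x \<in> set (drop h j) \<and> y \<in> set (drop h j) \<and> x \<noteq> y)"
    proof (rule ccontr)
      assume "\<not> ?thesis"
      then have "take h j = replicate h (hd (take h j))" "drop h j = replicate h (hd (drop h j))"
        using j by (intro const; auto)+
      then show False using False by (metis append_take_drop_id)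
    qed
    then show ?thesis using False col_sum_other[OF mg] by auto
  qed
  define z where "z = cis (pi / h)"
  have zh: "z ^ h = -1" unfolding z_def using h by (simp add: Complex.DeMoivre)
  have z: "z \<in> root_group s" "z \<noteq> 0"
    using zh by (auto simp: root_group_def n h power_add z_def)
  have D: "diag_one r z \<in> H s" by (rule diag_one_H[OF z])
  have cs: "col_sum (diag_one r z) (replicate h r) = -1" "col_sum (diag_one r z) (replicate h t) = 1"
  proof -
    have m: "monomial_matrix (diag_one r z)" using D by (simp add: H_def)
    show "col_sum (diag_one r z) (replicate h r) = -1"
      using col_sum_replicate[OF m h(4), of r r] z zh by (simp add: diag_one_def)
    show "col_sum (diag_one r z) (replicate h t) = 1"
      using col_sum_replicate[OF m h(4), of t t] rt(2) by (simp add: diag_one_def)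
  qed
  show ?thesis
  proof (intro exI, rule category_neq[OF partition_two_blocks[OF h(4)]])
    show "T_part [] (replicate (h + h) White) (two_blocks h)
           \<in> tannaka (classical (H_det s d :: (complex^'n^'n) set)) [] (replicate (h + h) White)"
      unfolding fix_two_blocks[OF h(4)] using inv by blast
    have "\<not> (\<forall>j :: 'n list. length j = h + h \<longrightarrow> (\<forall>g\<in>H s. col_sum g (take h j) * col_sum g (drop h j) =
        (if \<exists>a b. j = replicate h a @ replicate h b then 1 else (0::complex))))"
    proof
      assume "\<forall>j :: 'n list. length j = h + h \<longrightarrow> (\<forall>g\<in>H s. col_sum g (take h j) * col_sum g (drop h j) =
        (if \<exists>a b. j = replicate h a @ replicate h b then 1 else (0::complex)))"
      from this[rule_format, of "replicate h r @ replicate h t", OF _ D] show False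
        by (auto simp: cs)
    qed
    then show "T_part [] (replicate (h + h) White) (two_blocks h)
           \<notin> tannaka (classical (H s :: (complex^'n^'n) set)) [] (replicate (h + h) White)"
      unfolding fix_two_blocks[OF h(4)] by blast
  qed
qed

theorem envelope_formula_fails:
  assumes "s \<noteq> 0" and "d \<noteq> 0" and "2 dvd d"
    and "CARD('n::finite) = 1 \<and> \<not> s dvd d \<or> CARD('n) = 2 \<and> s \<noteq> \<infinity> \<and> 2 * d dvd s"
  shows "\<exists>k l. tannaka (classical (H s :: (complex^'n^'n) set)) k l
           \<noteq> lin_span (T_part k l ` D1 (classical (H_det s d :: (complex^'n^'n) set)) k l)"
  using assms H_fails_one H_fails_two by metis

end

theory Submission
  imports Defs
begin

text \<open>
  Since \<open>d\<close> is even, every element of $H_N^{s,d}$ is a permutation matrix times a diagonal matrix from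
  $D^{s,d} = \{z \in \mathbb{Z}_s^N \mid \prod_a z_a \in \mathbb{Z}_d\}$ (lemma \<open>H_det_eq\<close>), and
  $H_N^s$ is the case \<open>d = \<infinity>\<close> (lemma \<open>H_eq_H_det\<close>). So an operator $T$ is in the
  Tannakian category of $H_N^{s,d}$ if and only if its matrix is invariant under permutations of the $N$ indices
  and is supported on the pairs of multi-indices $x = (j, i)$ that are balanced, meaning that each $z \in D^{s,d}$
  acts by the same scalar on $e_j$ and on $e_i$ (lemma \<open>tannaka_H_det_iff\<close>). For an arbitrary map $f$ of
  the index set, applying $f$ to all entries of $x$ turns the condition at $z$ into the condition at $z \circ f$.

  If $\pi$ is the kernel partition of $x$, then $T_\pi$ is the indicator of the set of all $f(x)$. Hence the
  indicator of the orbit of $x$ under permutations is $T_\pi$ minus the indicators of the orbits of those $f(x)$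
  that have fewer distinct entries. By induction, an invariant $T$ is a combination of the $T_\pi$ for the kernels
  $\pi$ of the $f(x)$ with $T(x) \neq 0$ (lemma \<open>tannaka_in_span\<close>). For $H_N^s$ the map
  $z \mapsto z \circ f$ preserves $\mathbb{Z}_s^N$, so these $\pi$ are all in $D^1$. This shows that the category
  of $H_N^s$ is contained in the span. For $(2,4,2)$ the maps $z \mapsto z \circ f$ also preserve $D^{4,2}$, because a
  map of two points is bijective or constant and the square of a fourth root of unity is $\pm 1$.

  For the other inclusion, take $\pi \in D^1$ and $x$ with $T_\pi(x) \neq 0$. Then also
  $T_\pi(f(x)) \neq 0$, so $x$ is balanced for all $z \circ f$ with $z \in D^{s,d}$, and these functions
  generate $\mathbb{Z}_s^N$ (lemma \<open>balanced_all_diagonals\<close>). For $N \geq 3$ they contain each function that is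
  $\zeta$ at one index and \<open>1\<close> elsewhere, as one coordinate of $z$ is free to correct the product. For
  $N = 2$ they generate the functions $(\zeta^2, 1)$ and $(\zeta^q, 1)$ for a suitable odd $q$, unless
  $2d \mid s < \infty$. For $N = 1$ the hypothesis $s \mid d$ gives $D^{s,d} = \mathbb{Z}_s$.

  It also has to be shown that a group of unitary matrices gives a Hopf ideal (lemma \<open>qsubgroup_classical\<close>).
  The comultiplication is the only difficulty: an element of the tensor square of the free algebra that vanishes on
  $G \times G$ lies in $I \otimes A + A \otimes I$, by the usual linear independence argument (lemma
  \<open>tensor_vanishing\<close>).
\<close>

section \<open>Closure properties of linear spans\<close>

lemma lin_span_zero: "(\<lambda>_. 0) \<in> lin_span S"
  unfolding lin_span_def by (auto intro!: exI[of _ "{}"])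

lemma lin_span_base:
  assumes "f \<in> S" shows "f \<in> lin_span S"
  unfolding lin_span_def using assms
  by (auto intro!: exI[of _ "{f}"] exI[of _ "\<lambda>_. 1"])

lemma lin_span_scale:
  assumes "f \<in> lin_span S" shows "(\<lambda>x. a * f x) \<in> lin_span S"
proof -
  obtain F c where F: "f = (\<lambda>x. \<Sum>h\<in>F. c h * h x)" "finite F" "F \<subseteq> S"
    using assms unfolding lin_span_def by blast
  have "(\<lambda>x. a * f x) = (\<lambda>x. \<Sum>h\<in>F. (a * c h) * h x)"
    by (simp add: F(1) sum_distrib_left mult.assoc)
  then show ?thesis unfolding lin_span_def mem_Collect_eq using F
    by (intro exI[of _ F] exI[of _ "\<lambda>h. a * c h"]) simp
qed

lemma lin_span_add:
  assumes "f \<in> lin_span S" "g \<in> lin_span S" shows "(\<lambda>x. f x + g x) \<in> lin_span S"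
proof -
  obtain F c where F: "f = (\<lambda>x. \<Sum>h\<in>F. c h * h x)" "finite F" "F \<subseteq> S"
    using assms(1) unfolding lin_span_def by blast
  obtain F' c' where F': "g = (\<lambda>x. \<Sum>h\<in>F'. c' h * h x)" "finite F'" "F' \<subseteq> S"
    using assms(2) unfolding lin_span_def by blast
  let ?c = "\<lambda>h. (if h \<in> F then c h else 0) + (if h \<in> F' then c' h else 0)"
  have 1: "(\<Sum>h\<in>F. c h * h x) = (\<Sum>h\<in>F \<union> F'. (if h \<in> F then c h else 0) * h x)" for x
    using F(2) F'(2) by (intro sum.mono_neutral_cong_left) auto
  have 2: "(\<Sum>h\<in>F'. c' h * h x) = (\<Sum>h\<in>F \<union> F'. (if h \<in> F' then c' h else 0) * h x)" for x
    using F(2) F'(2) by (intro sum.mono_neutral_cong_left) auto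
  have "(\<lambda>x. f x + g x) = (\<lambda>x. \<Sum>h\<in>F \<union> F'. ?c h * h x)"
    unfolding F(1) F'(1) 1 2 by (simp only: distrib_right sum.distrib)
  then show ?thesis unfolding lin_span_def mem_Collect_eq using F F'
    by (intro exI[of _ "F \<union> F'"] exI[of _ ?c]) simp
qed

lemma lin_span_sum:
  assumes "finite A" "\<And>a. a \<in> A \<Longrightarrow> f a \<in> lin_span S"
  shows "(\<lambda>x. \<Sum>a\<in>A. c a * f a x) \<in> lin_span S"
  using assms
proof (induction A rule: finite_induct)
  case empty
  then show ?case by (simp add: lin_span_zero)
next
  case (insert a A)
  then have "(\<lambda>x. c a * f a x + (\<Sum>a\<in>A. c a * f a x)) \<in> lin_span S"
    by (intro lin_span_add lin_span_scale) auto
  with insert show ?case by simp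
qed

lemma lin_span_diff:
  assumes "f \<in> lin_span S" "g \<in> lin_span S" shows "(\<lambda>x. f x - g x) \<in> lin_span S"
  using lin_span_add[OF assms(1) lin_span_scale[OF assms(2), of "-1"]] by simp

section \<open>Evaluation of noncommutative polynomials at a matrix\<close>

text \<open>
  The value at the matrix $g$ of the product of generators \<open>w\<close>, as in the definition of \<open>nc_eval\<close>.
\<close>

abbreviation word_eval :: "complex^'n^'n \<Rightarrow> 'n gen list \<Rightarrow> complex" where
  "word_eval g w \<equiv> \<Prod>x\<leftarrow>w. gen_eval g x"

lemma free_algI:
  assumes "finite S" "\<And>w. f w \<noteq> 0 \<Longrightarrow> w \<in> S" shows "f \<in> free_alg"
  unfolding free_alg_def using assms by (auto intro: finite_subset[of _ S])

lemma free_algD: "f \<in> free_alg \<Longrightarrow> finite {w. f w \<noteq> 0}"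
  by (simp add: free_alg_def)

lemma free_alg_zero: "(\<lambda>_. 0) \<in> free_alg"
  by (simp add: free_alg_def)

lemma nc_eval_zero: "nc_eval g (\<lambda>_. 0) = 0"
  by (simp add: nc_eval_def)

lemma
  assumes "f \<in> free_alg" "h \<in> free_alg"
  shows free_alg_add: "(\<lambda>w. f w + h w) \<in> free_alg"
    and nc_eval_add: "nc_eval g (\<lambda>w. f w + h w) = nc_eval g f + nc_eval g h"
proof -
  let ?S = "{w. f w \<noteq> 0} \<union> {w. h w \<noteq> 0}"
  have S: "finite ?S" using assms by (simp add: free_alg_def)
  show "(\<lambda>w. f w + h w) \<in> free_alg" by (rule free_algI[OF S]) auto
  have "nc_eval g (\<lambda>w. f w + h w) = (\<Sum>w\<in>?S. (f w + h w) * word_eval g w)"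
    by (rule nc_eval_superset[OF S]) auto
  also have "\<dots> = (\<Sum>w\<in>?S. f w * word_eval g w) + (\<Sum>w\<in>?S. h w * word_eval g w)"
    by (simp only: distrib_right sum.distrib)
  also have "(\<Sum>w\<in>?S. f w * word_eval g w) = nc_eval g f"
    by (rule nc_eval_superset[OF S, symmetric]) auto
  also have "(\<Sum>w\<in>?S. h w * word_eval g w) = nc_eval g h"
    by (rule nc_eval_superset[OF S, symmetric]) auto
  finally show "nc_eval g (\<lambda>w. f w + h w) = nc_eval g f + nc_eval g h" .
qed

lemma
  assumes "f \<in> free_alg"
  shows free_alg_scale: "(\<lambda>w. c * f w) \<in> free_alg"
    and nc_eval_scale: "nc_eval g (\<lambda>w. c * f w) = c * nc_eval g f"
proof -
  have S: "finite {w. f w \<noteq> 0}" using assms by (simp add: free_alg_def)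
  show "(\<lambda>w. c * f w) \<in> free_alg" by (rule free_algI[OF S]) auto
  have "nc_eval g (\<lambda>w. c * f w) = (\<Sum>w | f w \<noteq> 0. c * f w * word_eval g w)"
    by (rule nc_eval_superset[OF S]) auto
  then show "nc_eval g (\<lambda>w. c * f w) = c * nc_eval g f"
    by (simp add: nc_eval_def sum_distrib_left mult.assoc)
qed

lemma free_alg_mon: "mon v \<in> free_alg"
  by (rule free_algI[of "{v}"]) (auto simp: mon_def split: if_splits)

lemma nc_eval_mon: "nc_eval g (mon v) = word_eval g v"
  by (subst nc_eval_superset[of "{v}"]) (auto simp: mon_def split: if_splits)

lemma
  assumes "finite A"
  shows free_alg_sum_mon: "(\<lambda>w. \<Sum>a\<in>A. c a * mon (v a) w) \<in> free_alg"
    and nc_eval_sum_mon: "nc_eval g (\<lambda>w. \<Sum>a\<in>A. c a * mon (v a) w) = (\<Sum>a\<in>A. c a * word_eval g (v a))"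
proof -
  have "(\<lambda>w. \<Sum>a\<in>A. c a * mon (v a) w) \<in> free_alg \<and>
     nc_eval g (\<lambda>w. \<Sum>a\<in>A. c a * mon (v a) w) = (\<Sum>a\<in>A. c a * word_eval g (v a))"
    using assms
  proof (induction A rule: finite_induct)
    case empty
    then show ?case by (simp add: free_alg_zero nc_eval_zero)
  next
    case (insert a A)
    then show ?case
      using free_alg_add[OF free_alg_scale[OF free_alg_mon], of "\<lambda>w. \<Sum>a\<in>A. c a * mon (v a) w" "c a" "v a"]
      by (simp add: nc_eval_add free_alg_scale free_alg_mon nc_eval_scale nc_eval_mon)
  qed
  then show "(\<lambda>w. \<Sum>a\<in>A. c a * mon (v a) w) \<in> free_alg"
    "nc_eval g (\<lambda>w. \<Sum>a\<in>A. c a * mon (v a) w) = (\<Sum>a\<in>A. c a * word_eval g (v a))" by auto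
qed

lemma
  assumes "f \<in> free_alg" "h \<in> free_alg"
  shows free_alg_diff: "(\<lambda>w. f w - h w) \<in> free_alg"
    and nc_eval_diff: "nc_eval g (\<lambda>w. f w - h w) = nc_eval g f - nc_eval g h"
  using free_alg_add[OF assms(1) free_alg_scale[OF assms(2), of "-1"]]
    nc_eval_add[OF assms(1) free_alg_scale[OF assms(2), of "-1"]]
    nc_eval_scale[OF assms(2), of _ "-1"] by simp_all

lemma
  assumes "f \<in> free_alg" "h \<in> free_alg"
  shows free_alg_mult: "nc_mult f h \<in> free_alg"
    and nc_eval_mult: "nc_eval g (nc_mult f h) = nc_eval g f * nc_eval g h"
proof -
  let ?F = "{w. f w \<noteq> 0}" and ?H = "{w. h w \<noteq> 0}"
  have fin: "finite ?F" "finite ?H" using assms by (simp_all add: free_alg_def)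
  define S where "S = (\<lambda>(u, v). u @ v) ` (?F \<times> ?H)"
  have S: "finite S" and app: "\<And>u v. f u \<noteq> 0 \<Longrightarrow> h v \<noteq> 0 \<Longrightarrow> u @ v \<in> S"
    using fin by (auto simp: S_def)
  have sub: "w \<in> S" if "nc_mult f h w \<noteq> 0" for w
  proof -
    have "\<exists>m\<in>{..length w}. f (take m w) * h (drop m w) \<noteq> 0"
      using that unfolding nc_mult_def by (rule sum.not_neutral_contains_not_neutral) blast
    then obtain m where "f (take m w) \<noteq> 0" "h (drop m w) \<noteq> 0" by auto
    then show ?thesis using app[of "take m w" "drop m w"] by simp
  qed
  show "nc_mult f h \<in> free_alg" by (rule free_algI[OF S sub])
  let ?T = "{(w, m). w \<in> S \<and> m \<le> length w \<and> f (take m w) \<noteq> 0 \<and> h (drop m w) \<noteq> 0}"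
  have "nc_eval g (nc_mult f h) = (\<Sum>w\<in>S. nc_mult f h w * word_eval g w)"
    by (rule nc_eval_superset[OF S sub])
  also have "\<dots> = (\<Sum>w\<in>S. \<Sum>m\<le>length w. f (take m w) * h (drop m w) * word_eval g w)"
    by (simp add: nc_mult_def sum_distrib_right)
  also have "\<dots> = (\<Sum>(w, m)\<in>Sigma S (\<lambda>w. {..length w}). f (take m w) * h (drop m w) * word_eval g w)"
    using S by (subst sum.Sigma) auto
  also have "\<dots> = (\<Sum>(w, m)\<in>?T. f (take m w) * h (drop m w) * word_eval g w)"
    by (rule sum.mono_neutral_right) (use S in auto)
  also have "\<dots> = (\<Sum>(u, v)\<in>?F \<times> ?H. f u * h v * word_eval g (u @ v))"
  proof (rule sum.reindex_bij_witness[where i = "\<lambda>(u, v). (u @ v, length u)"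
        and j = "\<lambda>(w, m). (take m w, drop m w)"])
    fix x assume "x \<in> ?T"
    then obtain w m where x: "x = (w, m)" "f (take m w) \<noteq> 0" "h (drop m w) \<noteq> 0" "m \<le> length w"
      by auto
    show "(case (case x of (w, m) \<Rightarrow> (take m w, drop m w)) of (u, v) \<Rightarrow> f u * h v * word_eval g (u @ v)) =
        (case x of (w, m) \<Rightarrow> f (take m w) * h (drop m w) * word_eval g w)"
      by (simp only: x prod.case append_take_drop_id)
  qed (auto simp: app)
  also have "\<dots> = (\<Sum>u\<in>?F. \<Sum>v\<in>?H. (f u * word_eval g u) * (h v * word_eval g v))"
    by (simp add: sum.cartesian_product algebra_simps)
  also have "\<dots> = nc_eval g f * nc_eval g h"
    by (simp add: nc_eval_def sum_product)
  finally show "nc_eval g (nc_mult f h) = nc_eval g f * nc_eval g h" .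
qed

text \<open>
  The conjugate transpose.
\<close>

definition adj :: "complex^'n^'n \<Rightarrow> complex^'n^'n" where
  "adj g = (\<chi> i j. cnj (g $ j $ i))"

text \<open>
  The involution and the antipode both permute the monomials by an involution \<open>\<phi>\<close>, up to conjugating the
  coefficients.
\<close>

lemma nc_eval_reindex:
  assumes "f \<in> free_alg" and inv: "\<And>w. \<phi> (\<phi> w) = w"
  shows "(\<lambda>w. f (\<phi> w)) \<in> free_alg" "nc_eval g (\<lambda>w. f (\<phi> w)) = (\<Sum>w | f w \<noteq> 0. f w * word_eval g (\<phi> w))"
proof -
  have img: "{w. f (\<phi> w) \<noteq> 0} = \<phi> ` {w. f w \<noteq> 0}"
    using inv by (auto simp: image_iff) metis
  then show "(\<lambda>w. f (\<phi> w)) \<in> free_alg"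
    using assms(1) by (simp add: free_alg_def)
  show "nc_eval g (\<lambda>w. f (\<phi> w)) = (\<Sum>w | f w \<noteq> 0. f w * word_eval g (\<phi> w))"
    unfolding nc_eval_def img
    by (subst sum.reindex) (auto simp: inv intro: inj_on_inverseI[of _ \<phi>])
qed

lemma opp_opp [simp]: "opp (opp c) = c" by (cases c) auto

lemma
  assumes "f \<in> free_alg"
  shows free_alg_star: "nc_star f \<in> free_alg"
    and nc_eval_star: "nc_eval g (nc_star f) = cnj (nc_eval g f)"
proof -
  let ?\<phi> = "\<lambda>w. rev (map (\<lambda>(c, i, j). (opp c, i, j)) w)"
  have inv: "?\<phi> (?\<phi> w) = w" for w :: "('a gen) list"
    by (simp add: rev_map[symmetric] o_def case_prod_unfold)
  have f': "(\<lambda>w. cnj (f w)) \<in> free_alg" using assms by (simp add: free_alg_def)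
  have ev: "word_eval g (?\<phi> w) = cnj (word_eval g w)" for w
  proof (induction w)
    case (Cons x w)
    obtain c i j where "x = (c, i, j)" by (cases x)
    then show ?case using Cons by (cases c) auto
  qed simp
  have eq: "nc_star f = (\<lambda>w. (\<lambda>w. cnj (f w)) (?\<phi> w))" by (simp add: nc_star_def)
  show "nc_star f \<in> free_alg" unfolding eq by (rule nc_eval_reindex(1)[OF f' inv])
  have "nc_eval g (nc_star f) = (\<Sum>w | cnj (f w) \<noteq> 0. cnj (f w) * word_eval g (?\<phi> w))"
    unfolding eq by (rule nc_eval_reindex(2)[OF f' inv])
  then show "nc_eval g (nc_star f) = cnj (nc_eval g f)"
    by (simp only: ev) (simp add: nc_eval_def)
qed

lemma
  assumes "f \<in> free_alg"
  shows free_alg_antipode: "nc_antipode f \<in> free_alg"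
    and nc_eval_antipode: "nc_eval g (nc_antipode f) = nc_eval (adj g) f"
proof -
  let ?\<phi> = "\<lambda>w. rev (map (\<lambda>(c, i, j). (opp c, j, i)) w)"
  have inv: "?\<phi> (?\<phi> w) = w" for w :: "('a gen) list"
    by (simp add: rev_map[symmetric] o_def case_prod_unfold)
  have ev: "word_eval g (?\<phi> w) = word_eval (adj g) w" for w
  proof (induction w)
    case (Cons x w)
    obtain c i j where "x = (c, i, j)" by (cases x)
    then show ?case using Cons by (cases c) (auto simp: adj_def)
  qed simp
  have eq: "nc_antipode f = (\<lambda>w. f (?\<phi> w))" by (simp add: nc_antipode_def)
  show "nc_antipode f \<in> free_alg" unfolding eq by (rule nc_eval_reindex(1)[OF assms inv])
  show "nc_eval g (nc_antipode f) = nc_eval (adj g) f"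
    unfolding eq nc_eval_reindex(2)[OF assms inv] by (simp only: ev) (simp add: nc_eval_def)
qed

lemma nc_counit_eval: "nc_counit f = nc_eval (mat 1) f"
proof -
  have "word_eval (mat 1) w = (if \<forall>(c, i, j)\<in>set w. i = j then 1 else 0)" for w :: "'a gen list"
  proof (induction w)
    case (Cons x w)
    obtain c i j where "x = (c, i, j)" by (cases x)
    then show ?case using Cons by (cases c) (auto simp: mat_def)
  qed simp
  then show ?thesis by (simp add: nc_counit_def nc_eval_def)
qed

section \<open>Groups of unitary matrices as closed subgroups of $U_N^+$\<close>

instance colour :: finite
proof
  have "(UNIV :: colour set) = {White, Black}" using colour.exhaust by auto
  then show "finite (UNIV :: colour set)" by (metis finite.emptyI finite_insert)
qed

lemma finite_multi_idx: "finite {m :: 'n::finite list. length m = n}"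
  using finite_lists_length_eq[of "UNIV :: 'n set" n] by simp

lemma sum_lists_Suc:
  "(\<Sum>m | length m = Suc n. F m) = (\<Sum>a\<in>UNIV. \<Sum>m | length m = n. F (a # m))"
  for F :: "('n::finite) list \<Rightarrow> complex"
proof -
  have "{m :: 'n list. length m = Suc n} = (\<lambda>(a, m). a # m) ` (UNIV \<times> {m. length m = n})"
    by (auto simp: length_Suc_conv image_iff)
  moreover have "inj_on (\<lambda>(a, m). a # m) (UNIV \<times> {m :: 'n list. length m = n})"
    by (auto simp: inj_on_def)
  ultimately show ?thesis
    by (simp add: sum.reindex sum.cartesian_product case_prod_unfold)
qed

lemma map_entry:
  assumes "length is = length k" "length js = length k"
  shows "map fst (entry k is js) = k" "map (fst \<circ> snd) (entry k is js) = is"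
    "map (snd \<circ> snd) (entry k is js) = js"
  using assms unfolding entry_def by (simp_all flip: map_map)

lemma entry_map: "entry (map fst w) (map (fst \<circ> snd) w) (map (snd \<circ> snd) w) = w"
  unfolding entry_def by (induction w) auto

lemma length_entry [simp]:
  "length is = length k \<Longrightarrow> length js = length k \<Longrightarrow> length (entry k is js) = length k"
  by (simp add: entry_def)

lemma word_eval_matrix_mult:
  fixes g h :: "complex^'n::finite^'n"
  shows "word_eval (g ** h) x = (\<Sum>m | length m = length x.
    word_eval g (entry (map fst x) (map (fst \<circ> snd) x) m) *
    word_eval h (entry (map fst x) m (map (snd \<circ> snd) x)))"
proof (induction x)
  case Nil
  have "{m :: 'n list. m = []} = {[]}" by auto
  then show ?case by (simp add: entry_def)
next
  case (Cons y x)
  obtain c i j where y: "y = (c, i, j)" by (cases y)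
  have gen: "gen_eval (g ** h) (c, i, j) = (\<Sum>a\<in>UNIV. gen_eval g (c, i, a) * gen_eval h (c, a, j))"
    by (cases c) (simp_all add: matrix_matrix_mult_def)
  show ?case
    unfolding y length_Cons sum_lists_Suc
    by (simp add: entry_def gen Cons.IH[unfolded entry_def] sum_product mult_ac)
qed

text \<open>
  The coproduct of \<open>f\<close>, evaluated at \<open>(g, h)\<close>, is \<open>f\<close> evaluated at the product of \<open>g\<close> and \<open>h\<close>. The finite
  set \<open>L\<close> of monomials, which bounds the support in both arguments, does not depend on \<open>g\<close> and \<open>h\<close>.
\<close>

lemma nc_comult_eval:
  fixes f :: "('n::finite) ncpoly"
  assumes f: "f \<in> free_alg"
  obtains L where "finite L" "\<And>v w. nc_comult f (v, w) \<noteq> 0 \<Longrightarrow> v \<in> L \<and> w \<in> L"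
    "\<And>g h. (\<Sum>v\<in>L. \<Sum>w\<in>L. nc_comult f (v, w) * (word_eval g v * word_eval h w)) = nc_eval (g ** h) f"
proof -
  let ?F = "{w. f w \<noteq> 0}"
  have fin: "finite ?F" using f by (rule free_algD)
  define n where "n = Max (length ` ?F)"
  define L where "L = {w :: 'n gen list. length w \<le> n}"
  have L: "finite L"
    using finite_lists_length_le[of "UNIV :: 'n gen set" n] by (simp add: L_def)
  have len: "length w \<le> n" if "f w \<noteq> 0" for w
    using that fin by (auto simp: n_def)
  let ?left = "\<lambda>x m. entry (map fst x) (map (fst \<circ> snd) x) m :: 'n gen list"
  let ?right = "\<lambda>x m. entry (map fst x) m (map (snd \<circ> snd) x) :: 'n gen list"
  let ?join = "\<lambda>v w. entry (map fst v) (map (fst \<circ> snd) v) (map (snd \<circ> snd) w) :: 'n gen list"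
  let ?mid = "\<lambda>v w :: 'n gen list. map fst v = map fst w \<and> map (snd \<circ> snd) v = map (fst \<circ> snd) w"
  have cases: "?mid v w \<and> f (?join v w) \<noteq> 0" if "nc_comult f (v, w) \<noteq> 0" for v w
    using that by (auto simp: nc_comult_def split: if_splits)
  have lj: "length (?join v w) = length v" "length w = length v" if "?mid v w" for v w
  proof -
    show l: "length w = length v" using that by (metis length_map)
    show "length (?join v w) = length v" by (subst length_entry) (simp_all add: l)
  qed
  have sub: "v \<in> L \<and> w \<in> L" if "nc_comult f (v, w) \<noteq> 0" for v w
    using cases[OF that] lj[of v w] len[of "?join v w"] by (auto simp: L_def)
  have "(\<Sum>v\<in>L. \<Sum>w\<in>L. nc_comult f (v, w) * (word_eval g v * word_eval h w)) = nc_eval (g ** h) f"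
    for g h
  proof -
    let ?T = "{(v, w)\<in>L \<times> L. nc_comult f (v, w) \<noteq> 0}"
    have "nc_eval (g ** h) f = (\<Sum>x\<in>?F. \<Sum>m | length m = length x.
        f x * (word_eval g (?left x m) * word_eval h (?right x m)))"
      by (simp add: nc_eval_def word_eval_matrix_mult sum_distrib_left)
    also have "\<dots> = (\<Sum>(x, m)\<in>Sigma ?F (\<lambda>x. {m. length m = length x}).
        f x * (word_eval g (?left x m) * word_eval h (?right x m)))"
      using fin finite_multi_idx by (subst sum.Sigma) auto
    also have "\<dots> = (\<Sum>(v, w)\<in>?T. nc_comult f (v, w) * (word_eval g v * word_eval h w))"
    proof (rule sum.reindex_bij_witness[where j = "\<lambda>(x, m). (?left x m, ?right x m)"
          and i = "\<lambda>(v, w). (?join v w, map (snd \<circ> snd) v)"])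
      fix a :: "'n gen list \<times> 'n list" assume "a \<in> Sigma ?F (\<lambda>x. {m. length m = length x})"
      then obtain x m where a: "a = (x, m)" "f x \<noteq> 0" "length m = length x" by auto
      have com: "nc_comult f (?left x m, ?right x m) = f x"
        using a(3) by (simp add: nc_comult_def map_entry entry_map)
      show "(case case a of (x, m) \<Rightarrow> (?left x m, ?right x m) of (v, w) \<Rightarrow> (?join v w, map (snd \<circ> snd) v)) = a"
        using a(3) by (simp add: a(1) map_entry entry_map)
      show "(case a of (x, m) \<Rightarrow> (?left x m, ?right x m)) \<in> ?T"
        using com a sub[of "?left x m" "?right x m"] by simp
      show "(case case a of (x, m) \<Rightarrow> (?left x m, ?right x m) of
              (v, w) \<Rightarrow> nc_comult f (v, w) * (word_eval g v * word_eval h w)) =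
            (case a of (x, m) \<Rightarrow> f x * (word_eval g (?left x m) * word_eval h (?right x m)))"
        by (simp add: a(1) com)
    next
      fix b assume "b \<in> ?T"
      then obtain v w where b: "b = (v, w)" "nc_comult f (v, w) \<noteq> 0" by auto
      have m: "?mid v w" and nz: "f (?join v w) \<noteq> 0" using cases[OF b(2)] by auto
      have l: "length w = length v" using lj[of v w] m by blast
      have e: "map fst (?join v w) = map fst v" "map (fst \<circ> snd) (?join v w) = map (fst \<circ> snd) v"
        "map (snd \<circ> snd) (?join v w) = map (snd \<circ> snd) w"
        using l by (simp_all add: map_entry)
      have vw: "entry (map fst v) (map (fst \<circ> snd) v) (map (snd \<circ> snd) v) = v"
          "entry (map fst v) (map (snd \<circ> snd) v) (map (snd \<circ> snd) w) = w"
        by (rule entry_map) (simp only: m entry_map)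
      show "(case case b of (v, w) \<Rightarrow> (?join v w, map (snd \<circ> snd) v) of (x, m) \<Rightarrow> (?left x m, ?right x m)) = b"
        by (simp only: b(1) prod.case e vw)
      show "(case b of (v, w) \<Rightarrow> (?join v w, map (snd \<circ> snd) v)) \<in> Sigma ?F (\<lambda>x. {m. length m = length x})"
        using nz lj(1)[OF m] by (simp add: b(1))
    qed
    also have "\<dots> = (\<Sum>(v, w)\<in>L \<times> L. nc_comult f (v, w) * (word_eval g v * word_eval h w))"
      by (rule sum.mono_neutral_left) (use L in auto)
    finally show ?thesis by (simp add: sum.cartesian_product)
  qed
  with L sub show ?thesis by (rule that)
qed

text \<open>
  The elementary tensors in $I \otimes A$ and $A \otimes I$, where $A$ is the free algebra.
\<close>

abbreviation tensor_ideal :: "'n ncpoly set \<Rightarrow> ('n gen list \<times> 'n gen list \<Rightarrow> complex) set" where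
  "tensor_ideal I \<equiv> {nc_tensor a b | a b. a \<in> I \<and> b \<in> free_alg} \<union>
                    {nc_tensor a b | a b. a \<in> free_alg \<and> b \<in> I}"

text \<open>
  An element of $A \otimes A$ that vanishes on $G \times G$ lies in $I \otimes A + A \otimes I$, where $I$ is the
  ideal of \<open>G\<close>. The induction is on the number of monomials in the second argument: if they are linearly dependent as
  functions on \<open>G\<close>, one of them is eliminated modulo $A \otimes I$. If they are independent, all coefficients are
  in $I$.
\<close>

lemma tensor_vanishing:
  fixes G :: "(complex^'n::finite^'n) set"
  assumes "finite W" "finite V"
    and "\<And>v w. F (v, w) \<noteq> 0 \<Longrightarrow> v \<in> V \<and> w \<in> W"
    and "\<And>g h. g \<in> G \<Longrightarrow> h \<in> G \<Longrightarrow> (\<Sum>v\<in>V. \<Sum>w\<in>W. F (v, w) * (word_eval g v * word_eval h w)) = 0"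
  shows "F \<in> lin_span (tensor_ideal (classical G))"
  using assms
proof (induction "card W" arbitrary: W F)
  case 0
  then have "W = {}" by simp
  then have "F = (\<lambda>_. 0)" using 0(4) by fastforce
  then show ?case by (simp add: lin_span_zero)
next
  case (Suc n)
  note fW = Suc.prems(1) and fV = Suc.prems(2) and supp = Suc.prems(3) and van = Suc.prems(4)
  have slice_free: "(\<lambda>v. F (v, w)) \<in> free_alg" for w
    by (rule free_algI[OF fV]) (use supp in blast)
  have slice_eval: "nc_eval g (\<lambda>v. F (v, w)) = (\<Sum>v\<in>V. F (v, w) * word_eval g v)" for g w
    by (rule nc_eval_superset[OF fV]) (use supp in blast)
  have van': "(\<Sum>w\<in>W. nc_eval g (\<lambda>v. F (v, w)) * word_eval h w) = 0" if "g \<in> G" "h \<in> G" for g h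
    using van[OF that] by (subst (asm) sum.swap) (simp add: slice_eval sum_distrib_right mult.assoc)
  show ?case
  proof (cases "\<exists>c. (\<exists>w\<in>W. c w \<noteq> 0) \<and> (\<forall>h\<in>G. (\<Sum>w\<in>W. c w * word_eval h w) = 0)")
    case False
    have slice: "(\<lambda>v. F (v, w)) \<in> classical G" if w: "w \<in> W" for w
    proof -
      have "nc_eval g (\<lambda>v. F (v, w)) = 0" if "g \<in> G" for g
      proof (rule ccontr)
        assume nz: "nc_eval g (\<lambda>v. F (v, w)) \<noteq> 0"
        have "(\<exists>w\<in>W. nc_eval g (\<lambda>v. F (v, w)) \<noteq> 0) \<and>
            (\<forall>h\<in>G. (\<Sum>w\<in>W. nc_eval g (\<lambda>v. F (v, w)) * word_eval h w) = 0)"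
          using van'[OF that] nz w by blast
        then show False using False by (elim notE) (rule exI)
      qed
      then show ?thesis using slice_free by (simp add: classical_def)
    qed
    have "F = (\<lambda>x. \<Sum>w\<in>W. 1 * nc_tensor (\<lambda>v. F (v, w)) (mon w) x)"
    proof
      fix x :: "'n gen list \<times> 'n gen list"
      obtain v w' where x: "x = (v, w')" by (cases x)
      have "(\<Sum>w\<in>W. 1 * nc_tensor (\<lambda>v. F (v, w)) (mon w) x) = (\<Sum>w\<in>W. if w' = w then F (v, w) else 0)"
        by (intro sum.cong) (auto simp: nc_tensor_def mon_def x)
      also have "\<dots> = F x" using supp[of v w'] fW by (auto simp: x)
      finally show "F x = (\<Sum>w\<in>W. 1 * nc_tensor (\<lambda>v. F (v, w)) (mon w) x)" by simp
    qed
    also have "\<dots> \<in> lin_span (tensor_ideal (classical G))"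
      by (rule lin_span_sum[OF fW lin_span_base]) (use slice free_alg_mon in blast)
    finally show ?thesis .
  next
    case True
    then obtain c w0 where c: "w0 \<in> W" "c w0 \<noteq> 0" "\<And>h. h \<in> G \<Longrightarrow> (\<Sum>w\<in>W. c w * word_eval h w) = 0"
      by blast
    \<comment> \<open>the linear relation, normalized so that the monomial \<open>w0\<close> has coefficient 1\<close>
    let ?b = "\<lambda>w'. \<Sum>w\<in>W. (c w / c w0) * mon w w'"
    have b_val: "?b w = (if w \<in> W then c w / c w0 else 0)" for w
    proof -
      have "?b w = (\<Sum>w'\<in>W. if w = w' then c w' / c w0 else 0)"
        by (intro sum.cong) (auto simp: mon_def)
      then show ?thesis using fW by simp
    qed
    have b_eval: "(\<Sum>w\<in>W. (c w / c w0) * word_eval h w) = 0" if "h \<in> G" for h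
      using c(3)[OF that] by (simp flip: sum_divide_distrib)
    have b: "?b \<in> classical G"
      unfolding classical_def mem_Collect_eq nc_eval_sum_mon[OF fW]
      by (intro conjI ballI free_alg_sum_mon[OF fW] b_eval)
    let ?t = "nc_tensor (\<lambda>v. F (v, w0)) ?b"
    let ?F = "\<lambda>x. F x - ?t x"
    have t: "?t \<in> lin_span (tensor_ideal (classical G))"
      by (rule lin_span_base) (use slice_free b in blast)
    have tval: "?t (v, w) = F (v, w0) * (if w \<in> W then c w / c w0 else 0)" for v w
      unfolding nc_tensor_def prod.case b_val ..
    have F0: "?F (v, w0) = 0" for v using c(1,2) by (simp only: tval) simp
    have "?F \<in> lin_span (tensor_ideal (classical G))"
    proof (rule Suc.hyps(1)[of "W - {w0}"])
      show "n = card (W - {w0})" using Suc.hyps(2) c(1) fW by simp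
      show "v \<in> V \<and> w \<in> W - {w0}" if nz: "?F (v, w) \<noteq> 0" for v w
      proof -
        have "w \<noteq> w0" using nz F0[of v] by blast
        moreover have "F (v, w) \<noteq> 0 \<or> F (v, w0) \<noteq> 0 \<and> w \<in> W"
          using nz unfolding tval by (auto split: if_splits)
        ultimately show ?thesis using supp by blast
      qed
      fix g h assume gh: "g \<in> G" "h \<in> G"
      have "(\<Sum>v\<in>V. \<Sum>w\<in>W - {w0}. ?F (v, w) * (word_eval g v * word_eval h w)) =
         (\<Sum>v\<in>V. \<Sum>w\<in>W. ?F (v, w) * (word_eval g v * word_eval h w))"
        using F0 by (intro sum.cong refl sum.mono_neutral_left) (use fW in auto)
      also have "\<dots> = (\<Sum>v\<in>V. \<Sum>w\<in>W. F (v, w) * (word_eval g v * word_eval h w))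
          - (\<Sum>v\<in>V. \<Sum>w\<in>W. ?t (v, w) * (word_eval g v * word_eval h w))"
        by (simp only: left_diff_distrib sum_subtractf)
      also have "(\<Sum>v\<in>V. \<Sum>w\<in>W. ?t (v, w) * (word_eval g v * word_eval h w)) =
          (\<Sum>v\<in>V. F (v, w0) * word_eval g v) * (\<Sum>w\<in>W. (c w / c w0) * word_eval h w)"
        unfolding tval sum_product by (intro sum.cong refl) simp
      also have "\<dots> = 0" using b_eval[OF gh(2)] by simp
      finally show "(\<Sum>v\<in>V. \<Sum>w\<in>W - {w0}. ?F (v, w) * (word_eval g v * word_eval h w)) = 0"
        using van[OF gh] by simp
    qed (use fW fV in auto)
    from lin_span_add[OF this t] show ?thesis by simp
  qed
qed

lemma classical_biunitarity:
  fixes G :: "(complex^'n::finite^'n) set"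
  assumes "\<And>g. g \<in> G \<Longrightarrow> g ** adj g = mat 1"
  shows "biunitarity \<subseteq> classical G"
proof -
  have kron_free: "nc_kron i j \<in> free_alg" for i j :: 'n
    using free_alg_mon[of "[]"] by (cases "i = j") (simp_all add: nc_kron_def free_alg_zero)
  have kron_eval: "nc_eval g (nc_kron i j) = (if i = j then 1 else 0)" for g and i j :: 'n
    by (auto simp: nc_kron_def nc_eval_mon nc_eval_zero)
  have mem: "(\<lambda>w. (\<Sum>m\<in>UNIV. mon (v m) w) - nc_kron i j w) \<in> classical G"
    if "\<And>g. g \<in> G \<Longrightarrow> (\<Sum>m\<in>UNIV. word_eval g (v m)) = (if i = j then 1 else 0)"
    for v :: "'n \<Rightarrow> 'n gen list" and i j
    using free_alg_diff[OF free_alg_sum_mon[of UNIV "\<lambda>_. 1" v] kron_free[of i j]]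
      nc_eval_diff[OF free_alg_sum_mon[of UNIV "\<lambda>_. 1" v] kron_free[of i j]]
      nc_eval_sum_mon[of UNIV _ "\<lambda>_. 1" v] that
    by (simp add: classical_def kron_eval)
  have r: "(\<Sum>m\<in>UNIV. g $ i $ m * cnj (g $ j $ m)) = (if i = j then 1 else 0)" if "g \<in> G" for g i j
    using arg_cong[OF assms[OF that], of "\<lambda>A. A $ i $ j"]
    by (simp add: matrix_matrix_mult_def adj_def mat_def)
  have l: "(\<Sum>m\<in>UNIV. cnj (g $ m $ i) * g $ m $ j) = (if i = j then 1 else 0)" if "g \<in> G" for g i j
    using arg_cong[OF matrix_left_right_inverse[THEN iffD1, OF assms[OF that]], of "\<lambda>A. A $ i $ j"]
    by (simp add: matrix_matrix_mult_def adj_def mat_def)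
  show ?thesis
    unfolding biunitarity_def
    by (auto intro!: mem) (use r l in \<open>auto simp: mult.commute\<close>)
qed

lemma qsubgroup_classical:
  fixes G :: "(complex^'n::finite^'n) set"
  assumes unit: "\<And>g. g \<in> G \<Longrightarrow> g ** adj g = mat 1"
    and one: "mat 1 \<in> G"
    and mult: "\<And>g h. g \<in> G \<Longrightarrow> h \<in> G \<Longrightarrow> g ** h \<in> G"
    and inv: "\<And>g. g \<in> G \<Longrightarrow> adj g \<in> G"
  shows "qsubgroup (classical G)"
proof -
  have "star_ideal (classical G)"
    unfolding star_ideal_def classical_def
    by (auto simp: free_alg_zero free_alg_add free_alg_scale free_alg_mult free_alg_star
        nc_eval_zero nc_eval_add nc_eval_scale nc_eval_mult nc_eval_star)
  moreover have "nc_comult f \<in> lin_span (tensor_ideal (classical G))" if f: "f \<in> classical G" for f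
  proof -
    have "f \<in> free_alg" using f by (simp add: classical_def)
    then obtain L where L: "finite L" "\<And>v w. nc_comult f (v, w) \<noteq> 0 \<Longrightarrow> v \<in> L \<and> w \<in> L"
      "\<And>g h. (\<Sum>v\<in>L. \<Sum>w\<in>L. nc_comult f (v, w) * (word_eval g v * word_eval h w)) = nc_eval (g ** h) f"
      using nc_comult_eval by blast
    show ?thesis
      by (rule tensor_vanishing[OF L(1) L(1) L(2)])
        (use L(3) f mult in \<open>auto simp: classical_def\<close>)
  qed
  moreover have "nc_counit f = 0" "nc_antipode f \<in> classical G" if "f \<in> classical G" for f
    using that one inv
    by (auto simp: classical_def nc_counit_eval free_alg_antipode nc_eval_antipode)
  ultimately show ?thesis
    unfolding qsubgroup_def using classical_biunitarity[OF unit] by blast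
qed

section \<open>Roots of unity and complex reflection groups\<close>

lemma root_group_one: "1 \<in> root_group s"
  by (cases s) (auto simp: root_group_def)

lemma root_group_mult: "z \<in> root_group s \<Longrightarrow> w \<in> root_group s \<Longrightarrow> z * w \<in> root_group s"
  by (cases s) (auto simp: root_group_def power_mult_distrib norm_mult)

lemma root_group_cnj: "z \<in> root_group s \<Longrightarrow> cnj z \<in> root_group s"
  by (cases s) (auto simp: root_group_def simp flip: complex_cnj_power)

lemma root_group_power: "z \<in> root_group s \<Longrightarrow> z ^ m \<in> root_group s"
  by (induction m) (auto simp: root_group_one root_group_mult)

lemma root_group_norm: "s \<noteq> 0 \<Longrightarrow> z \<in> root_group s \<Longrightarrow> norm z = 1"
  by (cases s) (auto simp: root_group_def zero_enat_def dest: power_eq_1_iff)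

lemma root_group_cnj_mult: "s \<noteq> 0 \<Longrightarrow> z \<in> root_group s \<Longrightarrow> z * cnj z = 1"
  using root_group_norm[of s z] by (simp add: complex_norm_square[symmetric])

lemma root_group_nonzero: "s \<noteq> 0 \<Longrightarrow> z \<in> root_group s \<Longrightarrow> z \<noteq> 0"
  using root_group_norm[of s z] by auto

lemma root_group_minus_one: "2 dvd d \<Longrightarrow> -1 \<in> root_group d"
proof (cases d)
  case (enat n)
  assume "2 dvd d"
  then have "even n" using enat_dvd_iff[of 2 n] by (simp add: enat numeral_eq_enat)
  then show ?thesis by (simp add: root_group_def enat)
qed (simp add: root_group_def)

lemma root_group_uminus_iff: "2 dvd d \<Longrightarrow> - z \<in> root_group d \<longleftrightarrow> z \<in> root_group d"
  using root_group_mult[OF root_group_minus_one, of d z] root_group_mult[OF root_group_minus_one, of d "- z"]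
  by auto

text \<open>
  The product of the diagonal matrix with entries \<open>z\<close> and the permutation matrix of \<open>\<sigma>\<close>, so
  $e_j \mapsto z_{\sigma(j)} e_{\sigma(j)}$.
\<close>

definition weighted_perm :: "('n \<Rightarrow> complex) \<Rightarrow> ('n \<Rightarrow> 'n) \<Rightarrow> complex^'n^'n" where
  "weighted_perm z \<sigma> = (\<chi> i j. if i = \<sigma> j then z i else 0)"

text \<open>
  The group $D^{s,d}$ of the diagonal matrices in $H_N^{s,d}$, given by their diagonals.
\<close>

definition diagonals :: "enat \<Rightarrow> enat \<Rightarrow> ('n::finite \<Rightarrow> complex) set" where
  "diagonals s d = {z. (\<forall>a. z a \<in> root_group s) \<and> (\<Prod>a\<in>UNIV. z a) \<in> root_group d}"

lemma weighted_perm_mult: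
  assumes "bij \<sigma>"
  shows "weighted_perm z \<sigma> ** weighted_perm w \<tau> = weighted_perm (\<lambda>i. z i * w (inv \<sigma> i)) (\<sigma> \<circ> \<tau>)"
proof -
  have "(\<Sum>m\<in>UNIV. (if i = \<sigma> m then z i else 0) * (if m = \<tau> j then w m else 0)) =
     (if i = \<sigma> (\<tau> j) then z i * w (inv \<sigma> i) else 0)" for i j
  proof -
    have "(\<Sum>m\<in>UNIV. (if i = \<sigma> m then z i else 0) * (if m = \<tau> j then w m else 0)) =
       (\<Sum>m\<in>UNIV. if m = \<tau> j then (if i = \<sigma> m then z i else 0) * w m else 0)"
      by (intro sum.cong) auto
    then show ?thesis using assms by (simp add: bij_is_inj)
  qed
  then show ?thesis by (simp add: weighted_perm_def matrix_matrix_mult_def vec_eq_iff)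
qed

lemma weighted_perm_one: "weighted_perm (\<lambda>_. 1) id = mat 1"
  by (simp add: weighted_perm_def mat_def)

lemma adj_weighted_perm:
  assumes "bij \<sigma>"
  shows "adj (weighted_perm z \<sigma>) = weighted_perm (\<lambda>i. cnj (z (\<sigma> i))) (inv \<sigma>)"
  using assms by (auto simp: adj_def weighted_perm_def vec_eq_iff bij_is_surj surj_f_inv_f bij_is_inj)

lemma det_weighted_perm:
  fixes \<sigma> :: "'n::finite \<Rightarrow> 'n"
  assumes "bij \<sigma>"
  shows "det (weighted_perm z \<sigma>) = of_int (sign \<sigma>) * (\<Prod>a\<in>UNIV. z a)"
proof -
  have s: "\<sigma> permutes UNIV" using assms by (intro bij_imp_permutes) auto
  have inv: "inv \<sigma> permutes UNIV" by (rule permutes_inv[OF s])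
  have other: "(\<Prod>i\<in>UNIV. weighted_perm z \<sigma> $ i $ p i) = 0" if ne: "p \<noteq> inv \<sigma>" for p
  proof -
    obtain i where "p i \<noteq> inv \<sigma> i" using ne by (auto simp: fun_eq_iff)
    then have "i \<noteq> \<sigma> (p i)" using assms by (metis bij_inv_eq_iff)
    then have "weighted_perm z \<sigma> $ i $ p i = 0" by (simp add: weighted_perm_def)
    then show ?thesis by (intro prod_zero) auto
  qed
  have "det (weighted_perm z \<sigma>) =
      (\<Sum>p\<in>{inv \<sigma>}. of_int (sign p) * (\<Prod>i\<in>UNIV. weighted_perm z \<sigma> $ i $ p i))"
    unfolding det_def
    by (rule sum.mono_neutral_right) (use inv other in \<open>auto simp: finite_permutations\<close>)
  also have "\<dots> = of_int (sign (inv \<sigma>)) * (\<Prod>i\<in>UNIV. z i)"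
    using s by (simp add: weighted_perm_def permutes_inverses)
  finally show ?thesis using s by (simp add: sign_inverse permutation_permutes[of \<sigma>] exI[of _ UNIV])
qed

lemma monomial_matrix_iff:
  fixes g :: "complex^'n::finite^'n"
  shows "monomial_matrix g \<longleftrightarrow> (\<exists>z \<sigma>. bij \<sigma> \<and> (\<forall>a. z a \<noteq> 0) \<and> g = weighted_perm z \<sigma>)"
proof
  assume m: "monomial_matrix g"
  define \<sigma> where "\<sigma> j = (THE i. g $ i $ j \<noteq> 0)" for j
  have col: "g $ i $ j \<noteq> 0 \<longleftrightarrow> i = \<sigma> j" for i j
    using m theI_unique[of "\<lambda>i. g $ i $ j \<noteq> 0" i] unfolding monomial_matrix_def \<sigma>_def by blast
  have "j = j'" if "\<sigma> j = \<sigma> j'" for j j'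
  proof -
    have "g $ \<sigma> j $ j \<noteq> 0" "g $ \<sigma> j $ j' \<noteq> 0" using that col by simp_all
    then show ?thesis using m unfolding monomial_matrix_def by blast
  qed
  then have "inj \<sigma>" by (rule injI)
  then have b: "bij \<sigma>" by (simp add: bij_def finite_UNIV_inj_surj)
  define z where "z i = g $ i $ inv \<sigma> i" for i
  have "g = weighted_perm z \<sigma>"
    using b col by (auto simp: vec_eq_iff weighted_perm_def z_def bij_is_inj)
  moreover have "z a \<noteq> 0" for a
    unfolding z_def col using b by (simp add: bij_is_surj surj_f_inv_f)
  ultimately show "\<exists>z \<sigma>. bij \<sigma> \<and> (\<forall>a. z a \<noteq> 0) \<and> g = weighted_perm z \<sigma>" using b by blast
next
  assume "\<exists>z \<sigma>. bij \<sigma> \<and> (\<forall>a. z a \<noteq> 0) \<and> g = weighted_perm z \<sigma>"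
  then obtain z \<sigma> where g: "bij \<sigma>" "\<And>a. z a \<noteq> 0" "g = weighted_perm z \<sigma>" by blast
  have "g $ i $ j \<noteq> 0 \<longleftrightarrow> i = \<sigma> j" for i j using g(2,3) by (simp add: weighted_perm_def)
  then show "monomial_matrix g"
    using bij_inv_eq_iff[OF g(1)] unfolding monomial_matrix_def by metis
qed

lemma H_eq:
  assumes "s \<noteq> 0"
  shows "H s = {weighted_perm z \<sigma> | z \<sigma>. bij \<sigma> \<and> (\<forall>a. z a \<in> root_group s)}"
proof -
  have entries: "(\<forall>i j. weighted_perm z \<sigma> $ i $ j \<noteq> 0 \<longrightarrow> weighted_perm z \<sigma> $ i $ j \<in> root_group s) \<longleftrightarrow>
      (\<forall>a. z a \<in> root_group s)" if b: "bij \<sigma>" and nz: "\<forall>a. z a \<noteq> 0" for z and \<sigma> :: "'a \<Rightarrow> 'a"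
  proof -
    have "(\<forall>i j. weighted_perm z \<sigma> $ i $ j \<noteq> 0 \<longrightarrow> weighted_perm z \<sigma> $ i $ j \<in> root_group s) \<longleftrightarrow>
      (\<forall>i j. i = \<sigma> j \<longrightarrow> z i \<in> root_group s)" using nz by (auto simp: weighted_perm_def)
    also have "\<dots> \<longleftrightarrow> (\<forall>a. z a \<in> root_group s)" using b by (metis bij_inv_eq_iff)
    finally show ?thesis .
  qed
  show ?thesis
    unfolding H_def monomial_matrix_iff
    using entries root_group_nonzero[OF assms] by (auto; metis)
qed

text \<open>
  The sign of the permutation can be ignored in the determinant condition because \<open>d\<close> is even.
\<close>

lemma H_det_eq:
  assumes "s \<noteq> 0" "2 dvd d"
  shows "H_det s d = {weighted_perm z \<sigma> | z \<sigma>. bij \<sigma> \<and> z \<in> diagonals s d}"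
proof -
  have "det (weighted_perm z \<sigma>) \<in> root_group d \<longleftrightarrow> (\<Prod>a\<in>UNIV. z a) \<in> root_group d"
    if "bij \<sigma>" for z and \<sigma> :: "'a \<Rightarrow> 'a"
    using root_group_uminus_iff[OF assms(2)] by (simp add: det_weighted_perm[OF that] sign_def)
  then show ?thesis
    unfolding H_det_def H_eq[OF assms(1)] diagonals_def by auto
qed

lemma H_eq_H_det: "s \<noteq> 0 \<Longrightarrow> H s = H_det s \<infinity>"
proof -
  assume s: "s \<noteq> 0"
  have "2 dvd (\<infinity> :: enat)" by (auto simp: dvd_def numeral_eq_enat intro: exI[of _ \<infinity>])
  have "(\<Prod>a\<in>UNIV. z a) \<in> root_group \<infinity>" if "\<forall>a. z a \<in> root_group s" for z :: "'a \<Rightarrow> complex"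
    using root_group_norm[OF s] that by (simp add: root_group_def prod_norm[symmetric])
  then show ?thesis
    unfolding H_eq[OF s] H_det_eq[OF s \<open>2 dvd \<infinity>\<close>] diagonals_def by auto
qed

lemma diagonals_one: "(\<lambda>_. 1) \<in> diagonals s d"
  by (simp add: diagonals_def root_group_one)

lemma H_det_group:
  fixes g h :: "complex^'n::finite^'n"
  assumes s: "s \<noteq> 0" and d: "2 dvd d" and g: "g \<in> H_det s d"
  shows H_det_unitary: "g ** adj g = mat 1"
    and H_det_adj: "adj g \<in> H_det s d"
    and H_det_mult: "h \<in> H_det s d \<Longrightarrow> g ** h \<in> H_det s d"
proof -
  obtain z \<sigma> where z: "bij \<sigma>" "z \<in> diagonals s d" "g = weighted_perm z \<sigma>"
    using g unfolding H_det_eq[OF s d] by blast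
  have prod_perm: "(\<Prod>a\<in>UNIV. f (\<tau> a)) = (\<Prod>a\<in>UNIV. f a)" if "bij \<tau>" for f :: "'n \<Rightarrow> complex" and \<tau>
    using prod.reindex_bij_betw[OF that, of f] by simp
  have "z a * cnj (z (\<sigma> (inv \<sigma> a))) = 1" for a
    using z(1,2) root_group_cnj_mult[OF s] by (simp add: diagonals_def bij_is_surj surj_f_inv_f)
  moreover have "\<sigma> \<circ> inv \<sigma> = id" using bij_is_surj[OF z(1)] by (rule surj_iff[THEN iffD1])
  ultimately show "g ** adj g = mat 1"
    by (simp add: z(3) adj_weighted_perm[OF z(1)] weighted_perm_mult[OF z(1)] weighted_perm_one)
  have "(\<lambda>i. cnj (z (\<sigma> i))) \<in> diagonals s d"
    using z(2) prod_perm[OF z(1), of "\<lambda>a. cnj (z a)"] root_group_cnj[of "\<Prod>a\<in>UNIV. z a" d]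
    by (simp add: diagonals_def root_group_cnj)
  then show "adj g \<in> H_det s d"
    unfolding H_det_eq[OF s d] z(3) adj_weighted_perm[OF z(1)] using bij_imp_bij_inv[OF z(1)] by blast
  assume "h \<in> H_det s d"
  then obtain w \<tau> where w: "bij \<tau>" "w \<in> diagonals s d" "h = weighted_perm w \<tau>"
    unfolding H_det_eq[OF s d] by blast
  have "(\<lambda>i. z i * w (inv \<sigma> i)) \<in> diagonals s d"
    using z(2) w(2) prod_perm[OF bij_imp_bij_inv[OF z(1)], of w]
    by (simp add: diagonals_def prod.distrib root_group_mult)
  then show "g ** h \<in> H_det s d"
    unfolding H_det_eq[OF s d] z(3) w(3) weighted_perm_mult[OF z(1)] using bij_comp[OF w(1) z(1)] by blast
qed

lemma mat_one_H_det:
  assumes "s \<noteq> 0" "2 dvd d"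
  shows "mat 1 \<in> H_det s d"
  unfolding H_det_eq[OF assms] weighted_perm_one[symmetric] using bij_id diagonals_one by blast

lemma perm_matrices_H_det:
  assumes "s \<noteq> 0" "2 dvd d"
  shows "perm_matrices \<subseteq> H_det s d"
proof
  fix g :: "complex^'n^'n" assume "g \<in> perm_matrices"
  then obtain \<sigma> where "g = weighted_perm (\<lambda>_. 1) \<sigma>" "bij \<sigma>"
    by (auto simp: perm_matrices_def weighted_perm_def)
  then show "g \<in> H_det s d" unfolding H_det_eq[OF assms] using diagonals_one by blast
qed

section \<open>The Tannakian category of $H_N^{s,d}$\<close>

lemma tannaka_classical_iff:
  fixes G :: "(complex^'n::finite^'n) set"
  shows "T \<in> tannaka (classical G) k l \<longleftrightarrow>
    (\<forall>j i. (j, i) \<notin> multi_idx l \<times> multi_idx k \<longrightarrow> T (j, i) = 0) \<and>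
    (\<forall>j\<in>multi_idx l. \<forall>i\<in>multi_idx k. \<forall>g\<in>G.
       (\<Sum>j'\<in>multi_idx l. T (j', i) * word_eval g (entry l j j')) =
       (\<Sum>i'\<in>multi_idx k. T (j, i') * word_eval g (entry k i' i)))"
proof -
  have fin: "finite (multi_idx k :: 'n list set)" for k
    using finite_multi_idx by (simp add: multi_idx_def)
  note sm = free_alg_sum_mon[OF fin] nc_eval_sum_mon[OF fin]
  show ?thesis
    unfolding tannaka_def classical_def mem_Collect_eq
    by (simp only: free_alg_diff[OF sm(1) sm(1)] nc_eval_diff[OF sm(1) sm(1)] sm(2) simp_thms right_minus_eq)
qed

text \<open>
  The scalar by which the diagonal matrix \<open>z\<close> acts on the basis vector with multi-index \<open>is\<close> in the tensor power
  given by \<open>k\<close>: a white point at the index \<open>a\<close> contributes $z_a$, and a black one contributes $\bar z_a$.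
\<close>

definition weight :: "('n \<Rightarrow> complex) \<Rightarrow> colword \<Rightarrow> 'n list \<Rightarrow> complex" where
  "weight z k is = (\<Prod>(c, a)\<leftarrow>zip k is. case c of White \<Rightarrow> z a | Black \<Rightarrow> cnj (z a))"

lemma weight_map: "weight z k (map f is) = weight (z \<circ> f) k is"
  by (simp add: weight_def zip_map2 o_def case_prod_unfold cong: colour.case_cong)

lemma weight_one: "weight (\<lambda>_. 1) k is = 1"
proof -
  have "(\<Prod>(c, a :: 'a)\<leftarrow>xs. case c of White \<Rightarrow> (1::complex) | Black \<Rightarrow> cnj 1) = 1" for xs
    by (induction xs) (auto split: colour.split)
  then show ?thesis by (simp only: weight_def)
qed

lemma weight_mult: "weight (\<lambda>a. z a * w a) k is = weight z k is * weight w k is"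
proof -
  have "(\<Prod>(c, a)\<leftarrow>xs. case c of White \<Rightarrow> z a * w a | Black \<Rightarrow> cnj (z a * w a)) =
     (\<Prod>(c, a)\<leftarrow>xs. case c of White \<Rightarrow> z a | Black \<Rightarrow> cnj (z a)) *
     (\<Prod>(c, a)\<leftarrow>xs. case c of White \<Rightarrow> w a | Black \<Rightarrow> cnj (w a))" for xs
  proof (induction xs)
    case (Cons x xs)
    then show ?case by (cases x; cases "fst x") (simp_all add: mult_ac)
  qed simp
  then show ?thesis by (simp only: weight_def)
qed

lemma weight_nonzero: "(\<And>a. z a \<noteq> 0) \<Longrightarrow> weight z k is \<noteq> 0"
  by (auto simp: weight_def prod_list_zero_iff split: colour.splits)

lemma word_eval_weighted_perm:
  assumes "length is = length k" "length js = length k"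
  shows "word_eval (weighted_perm z \<sigma>) (entry k is js) = (if is = map \<sigma> js then weight z k is else 0)"
proof -
  have "length k = length is" "length is = length js" using assms by simp_all
  then show ?thesis
  proof (induction k "is" js rule: list_induct3)
    case (Cons c k i "is" j js)
    then show ?case by (cases c) (auto simp: entry_def weight_def weighted_perm_def)
  qed (simp add: entry_def weight_def)
qed

text \<open>
  The pairs \<open>(j, i)\<close> that index the matrices of operators from the tensor power given by \<open>k\<close> to that given by
  \<open>l\<close>, with the output multi-index first.
\<close>

definition indices :: "colword \<Rightarrow> colword \<Rightarrow> ('n list \<times> 'n list) set" where
  "indices k l = multi_idx l \<times> multi_idx k"

text \<open>
  A map \<open>f\<close> of the index set, not necessarily bijective, applied to all entries of both multi-indices.
\<close>

definition act :: "('n \<Rightarrow> 'n) \<Rightarrow> 'n list \<times> 'n list \<Rightarrow> 'n list \<times> 'n list" where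
  "act f x = (map f (fst x), map f (snd x))"

text \<open>
  The matrix unit at \<open>x\<close> intertwines the actions of the diagonal matrix \<open>z\<close> on the two tensor powers.
\<close>

definition balanced :: "('n \<Rightarrow> complex) \<Rightarrow> colword \<Rightarrow> colword \<Rightarrow> 'n list \<times> 'n list \<Rightarrow> bool" where
  "balanced z k l x \<longleftrightarrow> weight z l (fst x) = weight z k (snd x)"

lemma finite_indices: "finite (indices k l :: ('n::finite list \<times> 'n list) set)"
  unfolding indices_def multi_idx_def by (intro finite_cartesian_product finite_multi_idx)

lemma act_indices [simp]: "act f x \<in> indices k l \<longleftrightarrow> x \<in> indices k l"
  by (cases x) (simp add: act_def indices_def multi_idx_def)

lemma act_act: "act f (act g x) = act (f \<circ> g) x"
  by (simp add: act_def)

lemma act_id: "act id x = x"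
  by (simp add: act_def)

lemma balanced_act: "balanced z k l (act f x) \<longleftrightarrow> balanced (z \<circ> f) k l x"
  by (simp add: balanced_def act_def weight_map)

text \<open>
  Invariance under the permutation matrices and commutation with the diagonal matrices, which together generate the
  group.
\<close>

lemma tannaka_H_det_iff:
  fixes T :: "'n::finite list \<times> 'n list \<Rightarrow> complex"
  assumes s: "s \<noteq> 0" and d: "2 dvd d"
  shows "T \<in> tannaka (classical (H_det s d)) k l \<longleftrightarrow>
    (\<forall>x. x \<notin> indices k l \<longrightarrow> T x = 0) \<and>
    (\<forall>\<sigma> x. bij \<sigma> \<longrightarrow> x \<in> indices k l \<longrightarrow> T (act \<sigma> x) = T x) \<and>
    (\<forall>x. T x \<noteq> 0 \<longrightarrow> (\<forall>z\<in>diagonals s d. balanced z k l x))"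
proof -
  have fin: "finite (multi_idx k :: 'n list set)" for k
    using finite_multi_idx by (simp add: multi_idx_def)
  have L: "(\<Sum>j'\<in>multi_idx l. T (j', i) * word_eval (weighted_perm z \<sigma>) (entry l j j')) =
      T (map (inv \<sigma>) j, i) * weight z l j" if b: "bij \<sigma>" and j: "j \<in> multi_idx l" for z \<sigma> i j
  proof -
    have eq: "j = map \<sigma> j' \<longleftrightarrow> j' = map (inv \<sigma>) j" for j'
      using b by (auto simp: o_def bij_is_inj bij_is_surj surj_f_inv_f)
    have "(\<Sum>j'\<in>multi_idx l. T (j', i) * word_eval (weighted_perm z \<sigma>) (entry l j j')) =
        (\<Sum>j'\<in>multi_idx l. if j' = map (inv \<sigma>) j then T (j', i) * weight z l j else 0)"
      using j by (intro sum.cong refl) (simp add: multi_idx_def word_eval_weighted_perm eq)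
    also have "\<dots> = T (map (inv \<sigma>) j, i) * weight z l j"
      using j fin by (simp add: multi_idx_def)
    finally show ?thesis .
  qed
  have R: "(\<Sum>i'\<in>multi_idx k. T (j, i') * word_eval (weighted_perm z \<sigma>) (entry k i' i)) =
      T (j, map \<sigma> i) * weight z k (map \<sigma> i)" if i: "i \<in> multi_idx k" for z \<sigma> i j
  proof -
    have "(\<Sum>i'\<in>multi_idx k. T (j, i') * word_eval (weighted_perm z \<sigma>) (entry k i' i)) =
        (\<Sum>i'\<in>multi_idx k. if i' = map \<sigma> i then T (j, i') * weight z k (map \<sigma> i) else 0)"
      using i by (intro sum.cong refl) (simp add: multi_idx_def word_eval_weighted_perm)
    also have "\<dots> = T (j, map \<sigma> i) * weight z k (map \<sigma> i)"
      using i fin by (simp add: multi_idx_def)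
    finally show ?thesis .
  qed
  let ?E = "\<forall>j\<in>multi_idx l. \<forall>i\<in>multi_idx k. \<forall>g\<in>H_det s d.
       (\<Sum>j'\<in>multi_idx l. T (j', i) * word_eval g (entry l j j')) =
       (\<Sum>i'\<in>multi_idx k. T (j, i') * word_eval g (entry k i' i))"
  let ?S = "\<forall>x. x \<notin> indices k l \<longrightarrow> T x = 0"
  let ?I = "\<forall>\<sigma> x. bij \<sigma> \<longrightarrow> x \<in> indices k l \<longrightarrow> T (act \<sigma> x) = T x"
  let ?B = "\<forall>x. T x \<noteq> 0 \<longrightarrow> (\<forall>z\<in>diagonals s d. balanced z k l x)"
  have ball: "(\<forall>g\<in>H_det s d. Q g) \<longleftrightarrow> (\<forall>z\<in>diagonals s d. \<forall>\<sigma>. bij \<sigma> \<longrightarrow> Q (weighted_perm z \<sigma>))"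
    for Q :: "complex^'n^'n \<Rightarrow> bool"
    unfolding H_det_eq[OF s d] by blast
  have E: "?E \<longleftrightarrow> (\<forall>j\<in>multi_idx l. \<forall>i\<in>multi_idx k. \<forall>z\<in>diagonals s d. \<forall>\<sigma>. bij \<sigma> \<longrightarrow>
       T (map (inv \<sigma>) j, i) * weight z l j = T (j, map \<sigma> i) * weight z k (map \<sigma> i))"
    unfolding ball by (intro ball_cong all_cong1 imp_cong refl) (simp only: L R)
  have "?E \<longleftrightarrow> ?I \<and> ?B" if S: ?S
  proof
    assume "?E"
    note E' = this[unfolded E, rule_format]
    have I: "T (act \<sigma> x) = T x" if b: "bij \<sigma>" and x: "x \<in> indices k l" for \<sigma> x
    proof -
      obtain j i where x': "x = (j, i)" by (cases x)
      have "map (inv \<sigma>) (map \<sigma> j) = j" using b by (simp add: bij_is_inj)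
      then show ?thesis
        using E'[of "map \<sigma> j" i "\<lambda>_. 1" \<sigma>] x b
        by (simp add: x' indices_def multi_idx_def act_def diagonals_one weight_one del: map_map)
    qed
    have "balanced z k l x" if nz: "T x \<noteq> 0" and z: "z \<in> diagonals s d" for x z
    proof -
      obtain j i where x': "x = (j, i)" by (cases x)
      have "x \<in> indices k l" using S nz by blast
      then show ?thesis
        using E'[of j i z id] z nz by (simp add: x' indices_def balanced_def)
    qed
    with I show "?I \<and> ?B" by blast
  next
    assume IB: "?I \<and> ?B"
    show ?E unfolding E
    proof (intro ballI allI impI)
      fix j i :: "'n list" and z :: "'n \<Rightarrow> complex" and \<sigma> :: "'n \<Rightarrow> 'n"
      assume j: "j \<in> multi_idx l" and i: "i \<in> multi_idx k" and z: "z \<in> diagonals s d" and b: "bij (\<sigma> :: 'n \<Rightarrow> 'n)"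
      have "act \<sigma> (map (inv \<sigma>) j, i) = (j, map \<sigma> i)"
        using b by (simp add: act_def o_def bij_is_surj surj_f_inv_f)
      moreover have "(map (inv \<sigma>) j, i) \<in> indices k l" using j i by (simp add: indices_def multi_idx_def)
      ultimately have eq: "T (j, map \<sigma> i) = T (map (inv \<sigma>) j, i)"
        using IB b by metis
      show "T (map (inv \<sigma>) j, i) * weight z l j = T (j, map \<sigma> i) * weight z k (map \<sigma> i)"
      proof (cases "T (j, map \<sigma> i) = 0")
        case False
        then have "balanced z k l (j, map \<sigma> i)" using IB z by blast
        then show ?thesis by (simp add: eq balanced_def)
      qed (use eq in simp)
    qed
  qed
  moreover have "(\<forall>j i. (j, i) \<notin> multi_idx l \<times> multi_idx k \<longrightarrow> T (j, i) = 0) \<longleftrightarrow> ?S"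
    by (simp only: indices_def split_paired_All)
  ultimately show ?thesis unfolding tannaka_classical_iff by blast
qed

lemma lin_span_tannaka:
  assumes "s \<noteq> 0" "2 dvd d" "S \<subseteq> tannaka (classical (H_det s d)) k l"
  shows "lin_span S \<subseteq> tannaka (classical (H_det s d)) k l"
proof
  fix T assume "T \<in> lin_span S"
  then obtain F c where F: "finite F" "F \<subseteq> S" "T = (\<lambda>x. \<Sum>f\<in>F. c f * f x)"
    unfolding lin_span_def by blast
  have "f \<in> tannaka (classical (H_det s d)) k l" if "f \<in> F" for f using that F(2) assms(3) by blast
  then have f: "\<And>h x. h \<in> F \<Longrightarrow> x \<notin> indices k l \<Longrightarrow> h x = 0"
    "\<And>h \<sigma> x. h \<in> F \<Longrightarrow> bij \<sigma> \<Longrightarrow> x \<in> indices k l \<Longrightarrow> h (act \<sigma> x) = h x"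
    "\<And>h x z. h \<in> F \<Longrightarrow> h x \<noteq> 0 \<Longrightarrow> z \<in> diagonals s d \<Longrightarrow> balanced z k l x"
    unfolding tannaka_H_det_iff[OF assms(1,2)] by blast+
  have "T x = 0" if "x \<notin> indices k l" for x
    unfolding F(3) using f(1) that by (intro sum.neutral) simp
  moreover have "T (act \<sigma> x) = T x" if "bij \<sigma>" "x \<in> indices k l" for \<sigma> x
    unfolding F(3) using f(2) that by (intro sum.cong) simp_all
  moreover have "balanced z k l x" if nz: "T x \<noteq> 0" and z: "z \<in> diagonals s d" for x z
  proof -
    obtain h where "h \<in> F" "c h * h x \<noteq> 0"
      using nz unfolding F(3) by (rule sum.not_neutral_contains_not_neutral)
    then show ?thesis using f(3)[of h x z] z by simp
  qed
  ultimately show "T \<in> tannaka (classical (H_det s d)) k l"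
    unfolding tannaka_H_det_iff[OF assms(1,2)] by blast
qed

section \<open>Orbits of multi-indices\<close>

text \<open>
  The orbit under $S_N$ of a pair of multi-indices.
\<close>

definition orbit :: "'n list \<times> 'n list \<Rightarrow> ('n list \<times> 'n list) set" where
  "orbit x = {act \<sigma> x | \<sigma>. bij \<sigma>}"

lemma orbit_refl: "x \<in> orbit x"
  unfolding orbit_def using act_id bij_id by (metis (mono_tags, lifting) mem_Collect_eq)

lemma orbit_eq: "y \<in> orbit x \<Longrightarrow> orbit y = orbit x"
proof -
  have sub: "orbit y \<subseteq> orbit x" if "y \<in> orbit x" for x y :: "'n list \<times> 'n list"
    using that by (auto simp: orbit_def act_act) (metis bij_comp)
  assume y: "y \<in> orbit x"
  then obtain \<sigma> where \<sigma>: "bij \<sigma>" "y = act \<sigma> x" by (auto simp: orbit_def)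
  then have "x = act (inv \<sigma>) y" by (simp add: act_act bij_is_inj act_id)
  then have "x \<in> orbit y" using \<sigma>(1) bij_imp_bij_inv by (auto simp: orbit_def)
  then show ?thesis using sub y by blast
qed

lemma finite_orbit: "finite (orbit (x :: 'n::finite list \<times> 'n list))"
proof -
  have "orbit x \<subseteq> range (\<lambda>\<sigma>. act \<sigma> x)" by (auto simp: orbit_def)
  then show ?thesis by (rule finite_subset) simp
qed

text \<open>
  A function that is constant on orbits, cut off outside a finite union of orbits, is a combination of indicators of
  orbits. The division by the cardinality compensates for the sum running over all points of each orbit.
\<close>

lemma sum_orbits:
  fixes F :: "'n::finite list \<times> 'n list \<Rightarrow> complex"
  assumes "finite A" and inv: "\<And>x y. x \<in> A \<Longrightarrow> y \<in> orbit x \<Longrightarrow> y \<in> A \<and> F y = F x"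
  shows "(\<Sum>y\<in>A. (F y / of_nat (card (orbit y))) * indicator (orbit y) w) = (if w \<in> A then F w else 0)"
proof (cases "w \<in> A")
  case False
  then have "indicator (orbit y) w = (0 :: complex)" if "y \<in> A" for y
    using inv[OF that, of w] by (auto simp: indicator_def)
  then show ?thesis using False by simp
next
  case True
  have "(\<Sum>y\<in>A. (F y / of_nat (card (orbit y))) * indicator (orbit y) w) =
      (\<Sum>y\<in>orbit w. F w / of_nat (card (orbit w)))"
  proof (rule sum.mono_neutral_cong_right)
    show "orbit w \<subseteq> A" using inv[OF True] by blast
    show "\<forall>y\<in>A - orbit w. (F y / of_nat (card (orbit y))) * indicator (orbit y) w = 0"
    proof
      fix y assume "y \<in> A - orbit w"
      then have "w \<notin> orbit y" using orbit_eq orbit_refl by blast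
      then show "(F y / of_nat (card (orbit y))) * indicator (orbit y) w = 0" by simp
    qed
    show "(F y / of_nat (card (orbit y))) * indicator (orbit y) w = F w / of_nat (card (orbit w))"
      if "y \<in> orbit w" for y
      using orbit_eq[OF that] inv[OF True that] orbit_refl[of w] by (simp add: indicator_def)
  qed (rule assms)
  also have "\<dots> = F w" using finite_orbit[of w] orbit_refl[of w] by (auto simp: card_gt_0_iff)
  finally show ?thesis using True by simp
qed

text \<open>
  The set of the indices that occur in one of the two multi-indices.
\<close>

definition vals :: "'n list \<times> 'n list \<Rightarrow> 'n set" where
  "vals x = set (fst x) \<union> set (snd x)"

lemma vals_act: "vals (act f x) = f ` vals x"
  by (auto simp: vals_def act_def)

lemma act_cong: "(\<And>a. a \<in> vals x \<Longrightarrow> f a = g a) \<Longrightarrow> act f x = act g x"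
  by (simp add: vals_def act_def)

lemma extend_bij:
  fixes f :: "'n::finite \<Rightarrow> 'n"
  assumes "inj_on f A"
  obtains \<sigma> where "bij \<sigma>" "\<And>a. a \<in> A \<Longrightarrow> \<sigma> a = f a"
proof -
  have "card (- A) = card (- (f ` A))"
    using card_image[OF assms] by (simp add: Compl_eq_Diff_UNIV card_Diff_subset)
  then obtain h where h: "bij_betw h (- A) (- (f ` A))"
    using finite_same_card_bij[of "- A" "- (f ` A)"] by auto
  define \<sigma> where "\<sigma> a = (if a \<in> A then f a else h a)" for a
  have "bij_betw \<sigma> A (f ` A)"
    using inj_on_imp_bij_betw[OF assms] by (rule bij_betw_cong[THEN iffD1, rotated]) (simp add: \<sigma>_def)
  moreover have "bij_betw \<sigma> (- A) (- (f ` A))"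
    using h by (rule bij_betw_cong[THEN iffD1, rotated]) (simp add: \<sigma>_def)
  ultimately have "bij_betw \<sigma> (A \<union> - A) (f ` A \<union> - (f ` A))"
    by (rule bij_betw_combine) simp
  then have "bij \<sigma>" by simp
  then show ?thesis using that by (auto simp: \<sigma>_def)
qed

text \<open>
  If \<open>f\<close> does not identify any of the occurring indices, it can be replaced by a permutation.
\<close>

lemma act_orbit:
  fixes x :: "'n::finite list \<times> 'n list"
  assumes "card (vals (act f x)) = card (vals x)"
  shows "act f x \<in> orbit x"
proof -
  have "inj_on f (vals x)"
    using assms unfolding vals_act by (intro eq_card_imp_inj_on) (auto simp: vals_def)
  then obtain \<sigma> where "bij \<sigma>" "\<And>a. a \<in> vals x \<Longrightarrow> \<sigma> a = f a" using extend_bij by blast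
  then show ?thesis using act_cong[of x \<sigma> f] unfolding orbit_def mem_Collect_eq by metis
qed

section \<open>Partitions as operators\<close>

text \<open>
  The index placed at a point: upper points carry the input multi-index, lower points the output one.
\<close>

definition label :: "'n list \<times> 'n list \<Rightarrow> nat + nat \<Rightarrow> 'n" where
  "label x = case_sum (nth (snd x)) (nth (fst x))"

text \<open>
  The partition of the points according to the index placed at them.
\<close>

definition kernel :: "colword \<Rightarrow> colword \<Rightarrow> 'n list \<times> 'n list \<Rightarrow> (nat + nat) set set" where
  "kernel k l x = (\<lambda>a. {p \<in> {..<length k} <+> {..<length l}. label x p = a}) `
     label x ` ({..<length k} <+> {..<length l})"

lemma kernel_partition: "kernel k l x \<in> partitions k l"
  unfolding partitions_def mem_Collect_eq
  by (rule partition_onI) (auto simp: kernel_def disjnt_def)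

lemma T_part_iff:
  "T_part k l \<pi> y = (if y \<in> indices k l \<and> (\<forall>B\<in>\<pi>. \<forall>p\<in>B. \<forall>q\<in>B. label y p = label y q) then 1 else 0)"
  by (cases y) (simp add: T_part_def indices_def label_def)

lemma T_part_nonzero_iff:
  "T_part k l \<pi> y \<noteq> (0::complex) \<longleftrightarrow>
     y \<in> indices k l \<and> (\<forall>B\<in>\<pi>. \<forall>p\<in>B. \<forall>q\<in>B. label y p = label y q)"
proof -
  have "(if Q then 1 else 0) \<noteq> (0::complex) \<longleftrightarrow> Q" for Q by simp
  then show ?thesis unfolding T_part_iff by this
qed

lemma label_act:
  assumes "x \<in> indices k l" "p \<in> {..<length k} <+> {..<length l}"
  shows "label (act f x) p = f (label x p)"
  using assms by (cases x) (auto simp: label_def act_def indices_def multi_idx_def)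

text \<open>
  Identifying indices preserves the condition that indices are equal within each block.
\<close>

lemma T_part_act:
  assumes "\<pi> \<in> partitions k l" "T_part k l \<pi> y \<noteq> (0::complex)"
  shows "T_part k l \<pi> (act f y) \<noteq> (0::complex)"
proof -
  have y: "y \<in> indices k l" "\<forall>B\<in>\<pi>. \<forall>p\<in>B. \<forall>q\<in>B. label y p = label y q"
    using assms(2) unfolding T_part_nonzero_iff by blast+
  have "p \<in> {..<length k} <+> {..<length l}" if "B \<in> \<pi>" "p \<in> B" for B p
    using assms(1) that by (auto simp: partitions_def partition_on_def)
  then have "\<forall>B\<in>\<pi>. \<forall>p\<in>B. \<forall>q\<in>B. label (act f y) p = label (act f y) q"
    using y(2) label_act[OF y(1)] by metis
  then show ?thesis unfolding T_part_nonzero_iff using y(1) by (intro conjI) (simp_all only: act_indices)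
qed

text \<open>
  A pair of multi-indices is constant on the blocks of the kernel of \<open>x\<close> if and only if it arises from \<open>x\<close> by
  applying a map to the indices.
\<close>

lemma T_part_kernel:
  fixes x :: "'n list \<times> 'n list"
  assumes x: "x \<in> indices k l"
  shows "T_part k l (kernel k l x) = indicator (range (\<lambda>f. act f x))"
proof
  fix y :: "'n list \<times> 'n list"
  let ?X = "{..<length k} <+> {..<length l}"
  have "(\<forall>B\<in>kernel k l x. \<forall>p\<in>B. \<forall>q\<in>B. label y p = label y q) \<longleftrightarrow>
      (\<forall>p\<in>?X. \<forall>q\<in>?X. label x p = label x q \<longrightarrow> label y p = label y q)"
  proof -
    have "(\<forall>B\<in>(\<lambda>a. {p \<in> X. h p = a}) ` h ` X. \<forall>p\<in>B. \<forall>q\<in>B. Q p q) \<longleftrightarrow>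
        (\<forall>p\<in>X. \<forall>q\<in>X. h p = h q \<longrightarrow> Q p q)" for X and h :: "nat + nat \<Rightarrow> 'n" and Q
      by auto
    then show ?thesis unfolding kernel_def by this
  qed
  moreover have "y \<in> indices k l \<and> (\<forall>p\<in>?X. \<forall>q\<in>?X. label x p = label x q \<longrightarrow> label y p = label y q)
     \<longleftrightarrow> y \<in> range (\<lambda>f. act f x)" (is "?L \<longleftrightarrow> ?R")
  proof
    assume L: ?L
    define f where "f a = label y (SOME p. p \<in> ?X \<and> label x p = a)" for a
    have f: "f (label x p) = label y p" if p: "p \<in> ?X" for p
    proof -
      let ?q = "SOME q. q \<in> ?X \<and> label x q = label x p"
      have q: "?q \<in> ?X \<and> label x ?q = label x p" by (rule someI[of _ p]) (use p in simp)
      show ?thesis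
        unfolding f_def by (rule L[THEN conjunct2, rule_format, OF conjunct1[OF q] p conjunct2[OF q]])
    qed
    have "y = act f x"
    proof -
      have len: "length (fst y) = length l" "length (fst x) = length l"
        "length (snd y) = length k" "length (snd x) = length k"
        using L x by (auto simp: indices_def multi_idx_def)
      have "fst y = map f (fst x)"
        using f[OF InrI, of "_ :: nat"] len by (intro nth_equalityI) (simp_all add: label_def)
      moreover have "snd y = map f (snd x)"
        using f[OF InlI, of "_ :: nat"] len by (intro nth_equalityI) (simp_all add: label_def)
      ultimately show ?thesis by (simp add: act_def prod_eq_iff)
    qed
    then show ?R by blast
  next
    assume ?R
    then obtain f where "y = act f x" by blast
    then show ?L using x by (auto simp: label_act[OF x])
  qed
  ultimately have iff: "y \<in> indices k l \<and> (\<forall>B\<in>kernel k l x. \<forall>p\<in>B. \<forall>q\<in>B. label y p = label y q) \<longleftrightarrow>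
      y \<in> range (\<lambda>f. act f x)" by (simp only:)
  show "T_part k l (kernel k l x) y = (indicator (range (\<lambda>f. act f x)) y :: complex)"
    unfolding T_part_iff iff by (simp add: indicator_def)
qed

lemma T_part_tannaka_iff:
  assumes "s \<noteq> 0" "2 dvd d" "\<pi> \<in> partitions k l"
  shows "(T_part k l \<pi> :: 'n::finite list \<times> 'n list \<Rightarrow> complex) \<in> tannaka (classical (H_det s d)) k l \<longleftrightarrow>
    (\<forall>x :: 'n list \<times> 'n list. T_part k l \<pi> x \<noteq> (0::complex) \<longrightarrow> (\<forall>z\<in>diagonals s d. balanced z k l x))"
proof -
  have "(T_part k l \<pi> (act \<sigma> x) :: complex) = T_part k l \<pi> x" if b: "bij \<sigma>"
    for \<sigma> and x :: "'n list \<times> 'n list"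
  proof -
    have undo: "act (inv \<sigma>) (act \<sigma> x) = x" using b by (simp add: act_act bij_is_inj act_id)
    have iff: "T_part k l \<pi> (act \<sigma> x) \<noteq> (0::complex) \<longleftrightarrow> T_part k l \<pi> x \<noteq> (0::complex)"
    proof
      assume "T_part k l \<pi> (act \<sigma> x) \<noteq> (0::complex)"
      then have "T_part k l \<pi> (act (inv \<sigma>) (act \<sigma> x)) \<noteq> (0::complex)" by (rule T_part_act[OF assms(3)])
      then show "T_part k l \<pi> x \<noteq> (0::complex)" unfolding undo .
    qed (rule T_part_act[OF assms(3)])
    have one: "T_part k l \<pi> y = (1::complex)" if "T_part k l \<pi> y \<noteq> (0::complex)"
      for y :: "'n list \<times> 'n list"
      unfolding T_part_iff by (rule if_P[OF that[unfolded T_part_nonzero_iff]])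
    show ?thesis
    proof (cases "T_part k l \<pi> x = (0::complex)")
      case True
      then show ?thesis using iff by simp
    next
      case False
      then show ?thesis using one[of x] one[of "act \<sigma> x"] iff by simp
    qed
  qed
  moreover have "T_part k l \<pi> x = (0::complex)" if "x \<notin> indices k l" for x :: "'n list \<times> 'n list"
    using that by (simp add: T_part_iff)
  ultimately show ?thesis unfolding tannaka_H_det_iff[OF assms(1,2)] by blast
qed

text \<open>
  The points \<open>act f x\<close> outside the orbit of \<open>x\<close> have fewer distinct indices than \<open>x\<close>, so the triangular
  relation between the indicators of orbits and the operators of partitions can be inverted by induction.
\<close>

lemma orbit_in_span:
  fixes P :: "('n::finite list \<times> 'n list) set"
  assumes P: "P \<subseteq> indices k l" "\<And>f x. x \<in> P \<Longrightarrow> act f x \<in> P"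
    and S: "\<And>x. x \<in> P \<Longrightarrow> T_part k l (kernel k l x) \<in> S"
    and x: "x \<in> P"
  shows "indicator (orbit x) \<in> lin_span S"
  using x
proof (induction "card (vals x)" arbitrary: x rule: less_induct)
  case less
  let ?R = "range (\<lambda>f. act f x) - orbit x"
  have sub: "orbit x \<subseteq> range (\<lambda>f. act f x)" by (auto simp: orbit_def)
  have R: "finite ?R" by simp
  have closed: "y' \<in> ?R" if "y \<in> ?R" "y' \<in> orbit y" for y y'
  proof -
    have "y' \<in> range (\<lambda>f. act f x)" using that by (auto simp: orbit_def act_act)
    moreover have "y' \<notin> orbit x" using that orbit_eq orbit_refl by blast
    ultimately show ?thesis by blast
  qed
  have IH: "indicator (orbit y) \<in> lin_span S" if y: "y \<in> ?R" for y
  proof (rule less.hyps)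
    obtain f where f: "y = act f x" using y by blast
    have "card (vals y) \<noteq> card (vals x)" using act_orbit[of f x] y by (auto simp: f)
    moreover have "card (vals y) \<le> card (vals x)"
      unfolding f vals_act by (rule card_image_le) (simp add: vals_def)
    ultimately show "card (vals y) < card (vals x)" by simp
    show "y \<in> P" using P(2)[OF less.prems] by (simp add: f)
  qed
  have "indicator (orbit x) = (\<lambda>w. T_part k l (kernel k l x) w -
      (\<Sum>y\<in>?R. (1 / of_nat (card (orbit y))) * indicator (orbit y) w) :: complex)"
  proof
    fix w
    have "(\<Sum>y\<in>?R. (1 / of_nat (card (orbit y))) * indicator (orbit y) w) = (if w \<in> ?R then 1 else 0 :: complex)"
      by (rule sum_orbits[OF R, of "\<lambda>_. 1"]) (use closed in blast)
    moreover have "T_part k l (kernel k l x) w = (indicator (range (\<lambda>f. act f x)) w :: complex)"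
      using T_part_kernel[of x k l] less.prems P(1) by auto
    ultimately show "indicator (orbit x) w = T_part k l (kernel k l x) w -
      (\<Sum>y\<in>?R. (1 / of_nat (card (orbit y))) * indicator (orbit y) w :: complex)"
      using sub by (auto simp: indicator_def)
  qed
  also have "\<dots> \<in> lin_span S"
    by (intro lin_span_diff lin_span_base lin_span_sum R S less.prems IH)
  finally show ?case .
qed

text \<open>
  If $D^{s,d} \subset D^{s,d'}$, the category of $H_N^{s,d'}$ is contained in the span of the partitions for
  $H_N^{s,d}$ as soon as the set \<open>P\<close> of the pairs balanced for $D^{s,d'}$ is closed under all maps of the index set.
  The cases used are $d' = \infty$ and $d' = d$.
\<close>

lemma tannaka_in_span:
  fixes P :: "('n::finite list \<times> 'n list) set"
  assumes s: "s \<noteq> 0" and d: "2 dvd d" and d': "2 dvd d'"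
    and P: "P = {x \<in> indices k l. \<forall>z\<in>diagonals s d'. balanced z k l x}"
    and closed: "\<And>f x. x \<in> P \<Longrightarrow> act f x \<in> P"
    and le: "diagonals s d \<subseteq> (diagonals s d' :: ('n \<Rightarrow> complex) set)"
  shows "tannaka (classical (H_det s d' :: (complex^'n^'n) set)) k l \<subseteq>
     lin_span (T_part k l ` D1 (classical (H_det s d :: (complex^'n^'n) set)) k l)"
proof
  fix T :: "'n list \<times> 'n list \<Rightarrow> complex"
  let ?S = "T_part k l ` D1 (classical (H_det s d :: (complex^'n^'n) set)) k l
     :: ('n list \<times> 'n list \<Rightarrow> complex) set"
  assume "T \<in> tannaka (classical (H_det s d')) k l"
  note T = this[unfolded tannaka_H_det_iff[OF s d']]
  have "T_part k l (kernel k l x) \<in> ?S" if x: "x \<in> P" for x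
  proof -
    have x': "x \<in> indices k l" using x P by blast
    have "balanced z k l y" if y: "T_part k l (kernel k l x) y \<noteq> (0::complex)" and z: "z \<in> diagonals s d"
      for y :: "'n list \<times> 'n list" and z
    proof -
      have "y \<in> range (\<lambda>f. act f x)" using y unfolding T_part_kernel[OF x'] by (auto simp: indicator_def)
      then have "y \<in> P" using closed[OF x] by blast
      then show ?thesis using P z le by blast
    qed
    then show ?thesis
      unfolding D1_def using T_part_tannaka_iff[OF s d kernel_partition] kernel_partition by blast
  qed
  then have orb: "indicator (orbit x) \<in> lin_span ?S" if "x \<in> P" for x
    using orbit_in_span[of P k l ?S] that closed P by blast
  let ?A = "{x \<in> indices k l. T x \<noteq> 0}"
  have A: "finite ?A" by (rule finite_subset[OF _ finite_indices[of k l]]) blast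
  have AP: "?A \<subseteq> P" using T[THEN conjunct2, THEN conjunct2] unfolding P by blast
  have "T = (\<lambda>w. \<Sum>y\<in>?A. (T y / of_nat (card (orbit y))) * indicator (orbit y) w)"
  proof
    fix w
    have "(\<Sum>y\<in>?A. (T y / of_nat (card (orbit y))) * indicator (orbit y) w) = (if w \<in> ?A then T w else 0)"
      by (rule sum_orbits[OF A]) (use T in \<open>fastforce simp: orbit_def\<close>)
    also have "\<dots> = T w"
    proof (cases "w \<in> ?A")
      case False
      then have "T w = 0" using T by blast
      then show ?thesis using False by simp
    qed simp
    finally show "T w = (\<Sum>y\<in>?A. (T y / of_nat (card (orbit y))) * indicator (orbit y) w)" by (rule sym)
  qed
  also have "\<dots> \<in> lin_span ?S"
    by (rule lin_span_sum[OF A orb]) (use AP in blast)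
  finally show "T \<in> lin_span ?S" .
qed

section \<open>Diagonal matrices generated from $D^{s,d}$\<close>

lemma balanced_mult:
  "balanced z k l x \<Longrightarrow> balanced w k l x \<Longrightarrow> balanced (\<lambda>a. z a * w a) k l x"
  by (simp add: balanced_def weight_mult)

lemma balanced_cancel:
  assumes "balanced (\<lambda>a. z a * w a) k l x" "balanced w k l x" "\<And>a. w a \<noteq> 0"
  shows "balanced z k l x"
  using assms(1,2) weight_nonzero[of w, OF assms(3)] by (simp add: balanced_def weight_mult)

lemma diagonals_infinity: "s \<noteq> 0 \<Longrightarrow> diagonals s \<infinity> = {z. \<forall>a. z a \<in> root_group s}"
  using root_group_norm[of s] by (auto simp: diagonals_def root_group_def prod_norm[symmetric])

lemma infinity_dvd_enat: "\<infinity> dvd enat n \<Longrightarrow> n = 0"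
proof -
  assume "\<infinity> dvd enat n"
  then obtain y where "enat n = \<infinity> * y" by (elim dvdE)
  then show "n = 0" by (cases y) (auto simp: zero_enat_def split: if_splits)
qed

lemma root_group_dvd:
  assumes "s dvd d" "d \<noteq> 0"
  shows "root_group s \<subseteq> root_group d"
proof
  fix z assume z: "z \<in> root_group s"
  have s: "s \<noteq> 0" using assms by auto
  show "z \<in> root_group d"
  proof (cases d)
    case infinity
    then show ?thesis using root_group_norm[OF s z] by (simp add: root_group_def)
  next
    case (enat e)
    have "s \<noteq> \<infinity>"
    proof
      assume "s = \<infinity>"
      then show False using assms infinity_dvd_enat[of e] by (simp add: enat zero_enat_def)
    qed
    then obtain n where n: "s = enat n" by auto
    then have "n dvd e" using assms(1) enat by (simp add: enat_dvd_iff)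
    then show ?thesis using z by (auto simp: n enat root_group_def power_mult elim!: dvdE)
  qed
qed

text \<open>
  The diagonal with the entry \<open>\<zeta>\<close> at \<open>a\<close> and \<open>1\<close> elsewhere.
\<close>

definition single :: "'n \<Rightarrow> complex \<Rightarrow> 'n \<Rightarrow> complex" where
  "single a \<zeta> i = (if i = a then \<zeta> else 1)"

lemma balanced_from_single:
  fixes z :: "'n::finite \<Rightarrow> complex"
  assumes "\<And>a. balanced (single a (z a)) k l x"
  shows "balanced z k l x"
proof -
  have "balanced (\<lambda>i. if i \<in> A then z i else 1) k l x" if "finite A" for A
    using that
  proof (induction A rule: finite_induct)
    case empty
    then show ?case by (simp add: balanced_def weight_one)
  next
    case (insert a A)
    have "(\<lambda>i. if i \<in> insert a A then z i else 1) = (\<lambda>i. single a (z a) i * (if i \<in> A then z i else 1))"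
      using insert.hyps by (auto simp: single_def)
    then show ?case using balanced_mult[OF assms insert.IH] by simp
  qed
  from this[of UNIV] show ?thesis by simp
qed

lemma prod_single: "(\<Prod>i\<in>UNIV. single a \<zeta> i) = \<zeta>" for a :: "'n::finite"
  by (simp add: single_def prod.delta)

text \<open>
  For odd $s$ one can take $q = s$. For even $s$ the lcm is $s$, so $d \mid s$, and $q = s/d$ is odd because
  $2d \nmid s$.
\<close>

lemma odd_power_in_root_group:
  assumes s: "s \<noteq> 0" "s \<noteq> \<infinity>" and d: "d dvd lcm_two s" "\<not> 2 * d dvd s"
  obtains q where "odd q" "\<And>\<zeta>. \<zeta> \<in> root_group s \<Longrightarrow> \<zeta> ^ q \<in> root_group d"
proof -
  obtain n where n: "s = enat n" "0 < n" using s by (cases s) (auto simp: zero_enat_def)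
  show ?thesis
  proof (cases "even n")
    case False
    then show ?thesis using that[of n] root_group_one[of d] by (simp add: n root_group_def)
  next
    case True
    then have l: "lcm_two s = enat n" by (simp add: lcm_two_def n lcm_proj2_if_dvd)
    have "d \<noteq> \<infinity>"
    proof
      assume "d = \<infinity>"
      then show False using d(1) infinity_dvd_enat[of n] n(2) by (simp add: l)
    qed
    then obtain e where e: "d = enat e" by auto
    then have "e dvd n" using d(1) by (simp add: l enat_dvd_iff)
    then obtain q where q: "n = e * q" by (elim dvdE)
    have "\<not> 2 * e dvd n" using d(2) by (simp add: e n numeral_eq_enat enat_dvd_iff)
    then have "odd q" using q by (auto elim!: evenE)
    moreover have "\<zeta> ^ q \<in> root_group d" if "\<zeta> \<in> root_group s" for \<zeta>
      using that by (simp add: root_group_def n e q mult.commute flip: power_mult)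
    ultimately show ?thesis by (rule that)
  qed
qed

text \<open>
  For $N = 2$, the constant function $(\zeta, \zeta)$ is obtained from $(\zeta, \zeta^{-1})$ by identifying the two
  indices. Multiplying the two gives $(\zeta^2, 1)$. This suffices for $s = \infty$, where all elements are squares.
  Otherwise it suffices together with $(\zeta^q, 1)$ for an odd $q$ such that $\zeta^q \in \mathbb{Z}_d$.
\<close>

lemma balanced_single_two:
  fixes a :: "'n::finite"
  assumes N: "CARD('n) = 2" and s: "s \<noteq> 0" and d: "d dvd lcm_two s" "s = \<infinity> \<or> \<not> 2 * d dvd s"
    and bal: "\<And>f z. z \<in> diagonals s d \<Longrightarrow> balanced z k l (act f x)"
    and \<zeta>: "\<zeta> \<in> root_group s"
  shows "balanced (single a \<zeta>) k l x"
proof -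
  obtain b where ab: "UNIV = {a, b}" "a \<noteq> b"
  proof -
    obtain r t :: 'n where rt: "UNIV = {r, t}" "r \<noteq> t" using N by (auto simp: card_2_iff)
    have "a = r \<or> a = t" using rt(1) by auto
    then show ?thesis using that[of r] that[of t] rt by (auto simp: insert_commute)
  qed
  have square: "balanced (single a (\<omega> * \<omega>)) k l x" if \<omega>: "\<omega> \<in> root_group s" for \<omega>
  proof -
    let ?z = "\<lambda>i. single a \<omega> i * single b (cnj \<omega>) i"
    have un: "\<omega> * cnj \<omega> = 1" by (rule root_group_cnj_mult[OF s \<omega>])
    have z: "?z \<in> diagonals s d"
      using root_group_cnj[OF \<omega>] \<omega> ab(2)
      by (simp add: diagonals_def prod.distrib prod_single un root_group_one) (simp add: single_def root_group_one)
    have const: "?z \<circ> (\<lambda>_. a) = (\<lambda>_ :: 'n. \<omega>)" using ab(2) by (auto simp: single_def)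
    have "balanced (\<lambda>_. \<omega>) k l x" using bal[OF z, of "\<lambda>_. a"] unfolding balanced_act const .
    moreover have "balanced ?z k l x" using bal[OF z, of id] by (simp only: act_id)
    ultimately have "balanced (\<lambda>i. \<omega> * ?z i) k l x" by (rule balanced_mult)
    moreover have "(\<lambda>i. \<omega> * ?z i) = single a (\<omega> * \<omega>)"
    proof
      fix i
      have "i = a \<or> i = b" using ab(1) by auto
      then show "\<omega> * ?z i = single a (\<omega> * \<omega>) i" using ab(2) un by (auto simp: single_def)
    qed
    ultimately show ?thesis by simp
  qed
  show ?thesis
  proof (cases "s = \<infinity>")
    case True
    have "csqrt \<zeta> \<in> root_group s" using \<zeta> True by (simp add: root_group_def norm_csqrt)
    from square[OF this] show ?thesis by (simp flip: power2_eq_square)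
  next
    case False
    then obtain q where q: "odd q" "\<And>\<zeta>. \<zeta> \<in> root_group s \<Longrightarrow> \<zeta> ^ q \<in> root_group d"
      using odd_power_in_root_group[OF s _ d(1)] d(2) by blast
    then obtain m where m: "q = 2 * m + 1" by (elim oddE)
    have "single a (\<zeta> ^ q) \<in> diagonals s d"
      using q(2)[OF \<zeta>] root_group_power[OF \<zeta>, of q]
      by (simp add: diagonals_def prod_single) (simp add: single_def root_group_one)
    then have "balanced (single a (\<zeta> ^ q)) k l x" using bal[of _ id] by (simp only: act_id)
    moreover have "single a (\<zeta> ^ q) = (\<lambda>i. single a \<zeta> i * single a (\<zeta> ^ m * \<zeta> ^ m) i)"
      by (auto simp: single_def m power_add power_mult power2_eq_square power_mult_distrib)
    ultimately have "balanced (\<lambda>i. single a \<zeta> i * single a (\<zeta> ^ m * \<zeta> ^ m) i) k l x" by simp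
    then show ?thesis
      by (rule balanced_cancel[OF _ square[OF root_group_power[OF \<zeta>]]])
        (use root_group_nonzero[OF s \<zeta>] in \<open>simp add: single_def\<close>)
  qed
qed

text \<open>
  For $N \geq 3$, take $z$ to be $\zeta$ at $r$, $\zeta^{-1}$ at $u$ and \<open>1\<close> elsewhere. Its product is \<open>1\<close>. If $f$
  maps \<open>a\<close> to $r$ and all other indices to a third index $t$, then $z \circ f$ is $\zeta$ at \<open>a\<close> and \<open>1\<close>
  elsewhere.
\<close>

lemma balanced_single_three:
  fixes a :: "'n::finite"
  assumes N: "3 \<le> CARD('n)" and s: "s \<noteq> 0"
    and bal: "\<And>f z. z \<in> diagonals s d \<Longrightarrow> balanced z k l (act f x)"
    and \<zeta>: "\<zeta> \<in> root_group s"
  shows "balanced (single a \<zeta>) k l x"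
proof -
  obtain S :: "'n set" where "card S = 3" using obtain_subset_with_card_n[OF N] by auto
  then obtain r t u :: 'n where rtu: "r \<noteq> t" "t \<noteq> u" "r \<noteq> u" by (auto simp: card_3_iff)
  let ?z = "\<lambda>i. single r \<zeta> i * single u (cnj \<zeta>) i"
  have "?z \<in> diagonals s d"
    using root_group_cnj[OF \<zeta>] \<zeta> rtu root_group_cnj_mult[OF s \<zeta>]
    by (simp add: diagonals_def prod.distrib prod_single root_group_one) (simp add: single_def root_group_one)
  moreover have "?z \<circ> (\<lambda>i. if i = a then r else t) = single a \<zeta>"
    using rtu by (auto simp: single_def)
  ultimately show ?thesis
    using bal[of ?z "\<lambda>i. if i = a then r else t"] by (simp only: balanced_act)
qed

lemma balanced_all_diagonals:
  fixes x :: "'n::finite list \<times> 'n list"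
  assumes s: "s \<noteq> 0" and d: "d \<noteq> 0" "d dvd lcm_two s"
    and N1: "\<not> (CARD('n) = 1 \<and> \<not> s dvd d)" and N2: "\<not> (CARD('n) = 2 \<and> s \<noteq> \<infinity> \<and> 2 * d dvd s)"
    and bal: "\<And>f z. z \<in> diagonals s d \<Longrightarrow> balanced z k l (act f x)"
    and z: "z \<in> diagonals s \<infinity>"
  shows "balanced z k l x"
proof (rule balanced_from_single)
  fix a
  have za: "z a \<in> root_group s" using z by (simp add: diagonals_def)
  consider "CARD('n) = 1" | "CARD('n) = 2" | "3 \<le> CARD('n)"
    using zero_less_card_finite[where 'a = 'n] by linarith
  then show "balanced (single a (z a)) k l x"
  proof cases
    case 1
    then have "z a \<in> root_group d" using N1 root_group_dvd d(1) za by blast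
    then have "single a (z a) \<in> diagonals s d"
      using za by (simp add: diagonals_def prod_single) (simp add: single_def root_group_one)
    then show ?thesis using bal[of _ id] by (simp only: act_id)
  next
    case 2
    show ?thesis by (rule balanced_single_two[OF 2 s d(2) _ bal za]) (use N2 2 in auto)
  next
    case 3
    show ?thesis by (rule balanced_single_three[OF 3 s bal za])
  qed
qed

section \<open>Easy envelopes\<close>

lemma qsubgroup_H_det:
  assumes "s \<noteq> 0" "2 dvd d"
  shows "qsubgroup (classical (H_det s d))"
  by (rule qsubgroup_classical)
    (use H_det_unitary[OF assms] H_det_adj[OF assms] H_det_mult[OF assms] mat_one_H_det[OF assms]
      in blast)+

lemma homogeneous_H_det:
  assumes "s \<noteq> 0" "2 dvd d"
  shows "homogeneous (classical (H_det s d))"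
  unfolding homogeneous_def using qsubgroup_H_det[OF assms] perm_matrices_H_det[OF assms]
  by (auto simp: classical_def)

text \<open>
  If $T_\pi(x) \neq 0$ for a partition $\pi \in D^1$, then all $f(x)$ are balanced, not only $x$ itself.
\<close>

lemma D1_balanced:
  assumes s: "s \<noteq> 0" "2 dvd d"
    and \<pi>: "\<pi> \<in> D1 (classical (H_det s d :: (complex^'n::finite^'n) set)) k l"
    and x: "T_part k l \<pi> (x :: 'n list \<times> 'n list) \<noteq> (0::complex)"
    and z: "z \<in> diagonals s d"
  shows "balanced z k l (act f x)"
proof -
  have p: "\<pi> \<in> partitions k l" using \<pi> by (simp add: D1_def)
  have "(T_part k l \<pi> :: 'n list \<times> 'n list \<Rightarrow> complex) \<in> tannaka (classical (H_det s d)) k l"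
    using \<pi> by (simp add: D1_def)
  then show ?thesis
    unfolding T_part_tannaka_iff[OF s p] using T_part_act[OF p x] z by blast
qed

lemma two_dvd_infinity: "2 dvd (\<infinity> :: enat)"
  by (rule dvdI[of _ _ \<infinity>]) (simp add: numeral_eq_enat)

lemma easy_envelope_H:
  assumes s: "s \<noteq> 0" and d: "d \<noteq> 0" "2 dvd d" "d dvd lcm_two s"
    and N1: "\<not> (CARD('n::finite) = 1 \<and> \<not> s dvd d)"
    and N2: "\<not> (CARD('n) = 2 \<and> s \<noteq> \<infinity> \<and> 2 * d dvd s)"
  shows "easy_envelope (classical (H_det s d :: (complex^'n^'n) set)) (classical (H s))"
proof -
  have "tannaka (classical (H_det s \<infinity> :: (complex^'n^'n) set)) k l =
      lin_span (T_part k l ` D1 (classical (H_det s d :: (complex^'n^'n) set)) k l)" for k l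
  proof
    let ?P = "{x \<in> indices k l. \<forall>z\<in>diagonals s \<infinity>. balanced z k l x} :: ('n list \<times> 'n list) set"
    show "tannaka (classical (H_det s \<infinity> :: (complex^'n^'n) set)) k l \<subseteq>
      lin_span (T_part k l ` D1 (classical (H_det s d :: (complex^'n^'n) set)) k l)"
    proof (rule tannaka_in_span[OF s d(2) two_dvd_infinity, of ?P])
      show "act f x \<in> ?P" if "x \<in> ?P" for f x
        using that by (simp add: balanced_act diagonals_infinity[OF s])
      show "diagonals s d \<subseteq> (diagonals s \<infinity> :: ('n \<Rightarrow> complex) set)"
        unfolding diagonals_infinity[OF s] by (auto simp: diagonals_def)
    qed simp
    have "T_part k l ` D1 (classical (H_det s d :: (complex^'n^'n) set)) k l \<subseteq>
        tannaka (classical (H_det s \<infinity> :: (complex^'n^'n) set)) k l"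
    proof (rule image_subsetI)
      fix \<pi> assume \<pi>: "\<pi> \<in> D1 (classical (H_det s d :: (complex^'n^'n) set)) k l"
      have p: "\<pi> \<in> partitions k l" using \<pi> by (simp add: D1_def)
      have "balanced z k l x" if x: "T_part k l \<pi> x \<noteq> (0::complex)" and z: "z \<in> diagonals s \<infinity>"
        for x :: "'n list \<times> 'n list" and z
        by (rule balanced_all_diagonals[OF s d(1,3) N1 N2 D1_balanced[OF s d(2) \<pi> x] z])
      then show "(T_part k l \<pi> :: 'n list \<times> 'n list \<Rightarrow> complex) \<in> tannaka (classical (H_det s \<infinity>)) k l"
        unfolding T_part_tannaka_iff[OF s two_dvd_infinity p] by blast
    qed
    then show "lin_span (T_part k l ` D1 (classical (H_det s d :: (complex^'n^'n) set)) k l) \<subseteq>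
        tannaka (classical (H_det s \<infinity> :: (complex^'n^'n) set)) k l"
      by (rule lin_span_tannaka[OF s two_dvd_infinity])
  qed
  then show ?thesis
    unfolding easy_envelope_def H_eq_H_det[OF s]
    using homogeneous_H_det[OF s d(2)] qsubgroup_H_det[OF s two_dvd_infinity] by blast
qed

text \<open>
  The two indices are either permuted by \<open>f\<close> or both sent to the same index \<open>b\<close>. In the latter case the product is
  $z_b^2 = \pm 1$.
\<close>

lemma diagonals_4_2_comp:
  fixes z :: "'n::finite \<Rightarrow> complex" and f :: "'n \<Rightarrow> 'n"
  assumes N: "CARD('n) = 2" and z: "z \<in> diagonals 4 2"
  shows "z \<circ> f \<in> diagonals 4 2"
proof -
  have in4: "z a ^ 4 = 1" for a
    using z by (simp add: diagonals_def root_group_def numeral_eq_enat)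
  have "(\<Prod>a\<in>UNIV. z (f a)) \<in> root_group 2"
  proof (cases "bij f")
    case True
    then show ?thesis using z prod.reindex_bij_betw[OF True, of z] by (simp add: diagonals_def)
  next
    case False
    obtain r t :: 'n where rt: "UNIV = {r, t}" "r \<noteq> t" using N by (auto simp: card_2_iff)
    have "f r = f t"
    proof (rule ccontr)
      assume "f r \<noteq> f t"
      then have "inj f" using rt(1) by (metis (no_types, lifting) UNIV_I injI insertE singletonD)
      then show False using False by (simp add: bij_def finite_UNIV_inj_surj)
    qed
    then have "(\<Prod>a\<in>UNIV. z (f a)) = z (f t) ^ 2"
      unfolding rt(1) using rt(2) by (simp add: power2_eq_square)
    moreover have "(z (f t) ^ 2) ^ 2 = 1" using in4[of "f t"] by (simp flip: power_mult)
    ultimately show ?thesis by (simp add: root_group_def numeral_eq_enat)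
  qed
  then show ?thesis using z by (simp add: diagonals_def)
qed

lemma easy_envelope_H_4_2:
  assumes N: "CARD('n::finite) = 2"
  shows "easy_envelope (classical (H_det 4 2 :: (complex^'n^'n) set)) (classical (H_det 4 2))"
proof -
  have s: "(4::enat) \<noteq> 0" "2 dvd (2::enat)" by simp_all
  have "tannaka (classical (H_det 4 2 :: (complex^'n^'n) set)) k l =
      lin_span (T_part k l ` D1 (classical (H_det 4 2 :: (complex^'n^'n) set)) k l)" for k l
  proof
    let ?P = "{x \<in> indices k l. \<forall>z\<in>diagonals 4 2. balanced z k l x} :: ('n list \<times> 'n list) set"
    show "tannaka (classical (H_det 4 2 :: (complex^'n^'n) set)) k l \<subseteq>
      lin_span (T_part k l ` D1 (classical (H_det 4 2 :: (complex^'n^'n) set)) k l)"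
    proof (rule tannaka_in_span[OF s s(2), of ?P])
      show "act f x \<in> ?P" if "x \<in> ?P" for f x
        using that diagonals_4_2_comp[OF N, of _ f] by (simp add: balanced_act)
    qed simp_all
    show "lin_span (T_part k l ` D1 (classical (H_det 4 2 :: (complex^'n^'n) set)) k l) \<subseteq>
        tannaka (classical (H_det 4 2 :: (complex^'n^'n) set)) k l"
      by (rule lin_span_tannaka[OF s]) (auto simp: D1_def)
  qed
  then show ?thesis
    unfolding easy_envelope_def using homogeneous_H_det[OF s] qsubgroup_H_det[OF s] by blast
qed

theorem theorem4p5:
  fixes s d :: enat
  assumes "s \<noteq> 0" and "d \<noteq> 0" and "2 dvd d" and "d dvd lcm_two s"
  shows "(\<not> (CARD('n::finite) = 1 \<and> \<not> s dvd d) \<and>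
          \<not> (CARD('n) = 2 \<and> s \<noteq> \<infinity> \<and> 2 * d dvd s) \<longrightarrow>
          easy_envelope (classical (H_det s d :: (complex^'n^'n) set)) (classical (H s))) \<and>
         (CARD('n) = 2 \<and> s = 4 \<and> d = 2 \<longrightarrow>
          easy_envelope (classical (H_det s d :: (complex^'n^'n) set)) (classical (H_det s d)))"
  using easy_envelope_H[OF assms] easy_envelope_H_4_2 by blast

end
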